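(* Let $a_n=\binom{2n}{n}^2$ and $g(t)=\sum_{n\ge0}a_nt^n$ for $t\in[0,1/16)$ (so $g(t)=\frac{2}{\pi}\mathscr{K}(16t)$ with $\mathscr{K}(z)=\int_0^1\frac{dx}{\sqrt{(1-x^2)(1-zx^2)}}$). For each $\kappa>0$, the function $t\mapsto\kappa\ln g(t)-\ln t$ on $t\in(0,1/16)$ has a unique minimizer, denoted $T_*(\kappa)$. Moreover, if $n\to\infty$ and $k=k(n)$ with $k/n\to\kappa\in(0,\infty)$, then $$\mathcal{M}^{(k)}_n(\boldsymbol{a})\sim e^{k\ln g(T_*(k/n))-n\ln T_*(k/n)}\,\frac{1}{\sqrt{2\pi k\,v(\kappa)}},$$ where $$v(\kappa)=\left.\left(t\frac{d}{dt}\ln g(t)+t^2\frac{d^2}{dt^2}\ln g(t)\right)\right|_{t=T_*(\kappa)}.$$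
   Context: For a sequence $\boldsymbol{a}=(a_n)_{n\ge 0}$ and $k\in\mathbb{N}$, the $k$-fold convolution is $\mathcal{M}^{(k)}_n(\boldsymbol{a}) = \sum_{j_1,\dots,j_k\ge 0,\ j_1+\dots+j_k=n} a_{j_1}\cdots a_{j_k}$. *)

theory Defs
  imports "HOL-Analysis.Analysis" "HOL-Library.Landau_Symbols"
begin

definition conv_power :: "(nat \<Rightarrow> real) \<Rightarrow> nat \<Rightarrow> nat \<Rightarrow> real" where
  "conv_power a k n =
     (\<Sum>js \<in> {js :: nat list. length js = k \<and> sum_list js = n}. \<Prod>i<k. a (js ! i))"

definition central_binom_sq :: "nat \<Rightarrow> real" where
  "central_binom_sq n = (real ((2 * n) choose n))\<^sup>2"

definition genfun :: "real \<Rightarrow> real" where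
  "genfun t = (\<Sum>n. central_binom_sq n * t ^ n)"

text \<open>The argument is the parameter (the square of the modulus). The integrand is unbounded
  at \<open>x = 1\<close>; its value there is \<open>1 / 0 = 0\<close>, which does not affect the integral.\<close>

definition elliptic_K :: "real \<Rightarrow> real" where
  "elliptic_K z = integral {0..1} (\<lambda>x. 1 / sqrt ((1 - x\<^sup>2) * (1 - z * x\<^sup>2)))"

definition is_minimizer :: "real \<Rightarrow> real \<Rightarrow> bool" where
  "is_minimizer \<kappa> t \<longleftrightarrow>
     is_arg_min (\<lambda>s. \<kappa> * ln (genfun s) - ln s) (\<lambda>s. s \<in> {0<..<1/16}) t"

definition T_star :: "real \<Rightarrow> real" where
  "T_star \<kappa> = (THE t. is_minimizer \<kappa> t)"

definition asym_var :: "real \<Rightarrow> real" where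
  "asym_var \<kappa> = (let t = T_star \<kappa>; L = (\<lambda>s. ln (genfun s))
           in t * deriv L t + t\<^sup>2 * deriv (deriv L) t)"

end

theory Submission
  imports Defs "HOL-Probability.Probability"
begin

text \<open>
  Weighting \<open>n\<close> by \<open>a n * t ^ n / g t\<close> turns the coefficients into a probability distribution
  with mean \<open>t * g' t / g t\<close>, and \<open>conv_power a k n * t ^ n / g t ^ k\<close> into the probability that
  \<open>k\<close> independent samples add up to \<open>n\<close>. The derivative of \<open>\<kappa> * ln (g t) - ln t\<close> is
  \<open>(\<kappa> * mean t - 1) / t\<close>. The mean is strictly increasing, because \<open>t\<close> times its derivative is the
  variance, and it runs from \<open>0\<close> to \<open>\<infinity>\<close>, because \<open>g\<close> diverges at its radius of convergence;
  this gives the unique minimizer. At \<open>t = T_star (k / n)\<close> the sum of the samples has mean \<open>n\<close>, and the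
  asymptotics is a local central limit theorem at the mean. It is proved by Fourier inversion and
  dominated convergence, with a Gaussian bound on the characteristic function that is uniform for
  \<open>t\<close> near the limit point. The link with the elliptic integral is the binomial series of
  \<open>1 / sqrt (1 - z * x\<^sup>2)\<close>, integrated termwise by monotone convergence and Wallis' integrals.
\<close>

section \<open>The elliptic integral\<close>

text \<open>These numbers are both the coefficients of \<open>(1 - y) powr (-1/2)\<close> and the
  Wallis ratios. That double role produces their squares, which are
  \<open>central_binom_sq n / 16 ^ n\<close>, in the elliptic integral.\<close>

definition central_binom_ratio :: "nat \<Rightarrow> real" where
  "central_binom_ratio n = real ((2 * n) choose n) / 4 ^ n"

lemma central_binom_ratio_0 [simp]: "central_binom_ratio 0 = 1"
  by (simp add: central_binom_ratio_def)

lemma central_binom_ratio_Suc: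
  "central_binom_ratio (Suc n) = (2 * real n + 1) / (2 * real n + 2) * central_binom_ratio n"
proof -
  define c where "c = fact (2 * n) / (fact n * fact n :: real)"
  have c: "real ((2 * n) choose n) = c"
    unfolding c_def by (subst binomial_fact) (auto simp: mult_2)
  have "real ((2 * Suc n) choose Suc n) = fact (2 * n + 2) / (fact (n + 1) * fact (n + 1))"
    by (subst binomial_fact) (auto simp: numeral_2_eq_2)
  also have "\<dots> = (2 * real n + 2) * (2 * real n + 1) / ((real n + 1) * (real n + 1)) * c"
    unfolding c_def by (simp add: divide_simps) (simp add: algebra_simps)
  finally have c': "real ((2 * Suc n) choose Suc n) = \<dots>" .
  show ?thesis
    unfolding central_binom_ratio_def c c' by (simp add: divide_simps) (simp add: algebra_simps)
qed

lemma central_binom_ratio_pos: "central_binom_ratio n > 0"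
  by (simp add: central_binom_ratio_def)

lemma central_binom_ratio_gchoose: "central_binom_ratio n = (-1/2 gchoose n) * (-1) ^ n"
proof (induction n)
  case (Suc n)
  have *: "(-1/2 gchoose Suc n) = (-1/2 gchoose n) * (-1/2 - real n) / (real n + 1)"
    using gbinomial_mult_1[of "-1/2::real" n] by (simp add: field_simps)
  have "(-1/2 gchoose Suc n) * (-1) ^ Suc n
      = (2 * real n + 1) / (2 * real n + 2) * ((-1/2 gchoose n) * (-1) ^ n)"
    unfolding * by (simp add: divide_simps) (simp add: algebra_simps)
  with Suc show ?case
    by (simp only: central_binom_ratio_Suc)
qed auto

lemma inverse_sqrt_series:
  assumes "\<bar>y\<bar> < 1"
  shows "(\<lambda>n. central_binom_ratio n * y ^ n) sums (1 / sqrt (1 - y))"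
proof -
  have "(\<lambda>n. (-1/2 gchoose n) * (-y) ^ n) sums (1 + (-y)) powr (-1/2)"
    using assms by (intro gen_binomial_real) auto
  moreover have "(-1/2 gchoose n) * (-y) ^ n = central_binom_ratio n * y ^ n" for n
    by (subst power_minus) (simp add: central_binom_ratio_gchoose)
  moreover have "(1 + (-y)) powr (-1/2) = 1 / sqrt (1 - y)"
    using assms by (simp add: powr_minus_divide powr_half_sqrt)
  ultimately show ?thesis by simp
qed

text \<open>Wallis' integrals: the function \<open>?F\<close> vanishes at both endpoints, so
  integrating its derivative gives a two-term recursion, the same as that of
  \<open>central_binom_ratio\<close>.\<close>

lemma has_integral_even_power_arcsine:
  "((\<lambda>x. x ^ (2 * n) / sqrt (1 - x\<^sup>2)) has_integral (pi / 2 * central_binom_ratio n)) {0..1}"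
proof (induction n)
  case 0
  have "((\<lambda>x. 1 / sqrt (1 - x\<^sup>2)) has_integral (arcsin 1 - arcsin 0)) {0..1}"
  \<comment> \<open>The derivative of arcsin blows up at 1, so it is taken in the interior only,
    with continuity up to the endpoints.\<close>
  proof (rule fundamental_theorem_of_calculus_interior)
    show "continuous_on {0..1} arcsin"
      by (rule continuous_on_subset[OF continuous_on_arcsin']) auto
    fix x :: real assume "x \<in> {0<..<1}"
    thus "(arcsin has_vector_derivative 1 / sqrt (1 - x\<^sup>2)) (at x)"
      unfolding has_real_derivative_iff_has_vector_derivative[symmetric]
      by (auto intro!: derivative_eq_intros simp: field_simps)
  qed auto
  thus ?case by simp
next
  case (Suc n)
  let ?w = "\<lambda>n x::real. x ^ (2 * n) / sqrt (1 - x\<^sup>2)"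
  let ?F = "\<lambda>x::real. x ^ (2 * n + 1) * sqrt (1 - x\<^sup>2)"
  have "((\<lambda>x. (2 * n + 1) * ?w n x - (2 * n + 2) * ?w (Suc n) x) has_integral (?F 1 - ?F 0)) {0..1}"
  proof (rule fundamental_theorem_of_calculus_interior)
    fix x :: real assume x: "x \<in> {0<..<1}"
    have pos: "1 - x\<^sup>2 > 0" using x by (simp add: power_less_one_iff abs_square_less_1)
    have D1: "((\<lambda>x. x ^ (2 * n + 1)) has_real_derivative (2 * n + 1) * x ^ (2 * n)) (at x)"
      using DERIV_pow[of "2 * n + 1" x] by simp
    have D2: "((\<lambda>x. sqrt (1 - x\<^sup>2)) has_real_derivative - x / sqrt (1 - x\<^sup>2)) (at x)"
      using pos by (auto intro!: derivative_eq_intros simp: field_simps)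
    have D: "(?F has_real_derivative
       (2 * n + 1) * x ^ (2 * n) * sqrt (1 - x\<^sup>2) + x ^ (2 * n + 1) * (- x / sqrt (1 - x\<^sup>2))) (at x)"
      using DERIV_mult[OF D1 D2] by (simp add: mult_ac)
    define w where "w = sqrt (1 - x\<^sup>2)"
    have w: "w > 0" "w * w = 1 - x\<^sup>2" using pos by (auto simp: w_def)
    have "(2 * n + 1) * x ^ (2 * n) * w + x ^ (2 * n + 1) * (- x / w)
        = ((2 * n + 1) * x ^ (2 * n) * (w * w) - x ^ (2 * n + 2)) / w"
      using w(1) by (simp add: field_simps)
    also have "\<dots> = (2 * n + 1) * (x ^ (2 * n) / w) - (2 * n + 2) * (x ^ (2 * Suc n) / w)"
      unfolding w(2) using w(1) by (simp add: field_simps power2_eq_square)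
    finally show "(?F has_vector_derivative
        (2 * n + 1) * ?w n x - (2 * n + 2) * ?w (Suc n) x) (at x)"
      using D unfolding w_def has_real_derivative_iff_has_vector_derivative by simp
  qed (auto intro!: continuous_intros)
  hence "((\<lambda>x. (2 * n + 1) * ?w n x - (2 * n + 2) * ?w (Suc n) x) has_integral 0) {0..1}"
    by simp
  moreover have "((\<lambda>x. (2 * n + 1) * ?w n x) has_integral (2 * n + 1) * (pi / 2 * central_binom_ratio n)) {0..1}"
    by (intro has_integral_mult_right Suc.IH)
  ultimately have "((\<lambda>x. ((2 * n + 1) * ?w n x - ((2 * n + 1) * ?w n x - (2 * n + 2) * ?w (Suc n) x)) / (2 * n + 2))
      has_integral ((2 * n + 1) * (pi / 2 * central_binom_ratio n) - 0) / (2 * n + 2)) {0..1}"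
    by (intro has_integral_divide has_integral_diff)
  also have "(\<lambda>x. ((2 * n + 1) * ?w n x - ((2 * n + 1) * ?w n x - (2 * n + 2) * ?w (Suc n) x)) / (2 * n + 2))
     = ?w (Suc n)"
    by (intro ext) (simp del: mult_Suc_right)
  also have "((2 * n + 1) * (pi / 2 * central_binom_ratio n) - 0) / (2 * n + 2)
     = pi / 2 * central_binom_ratio (Suc n)"
    by (simp add: central_binom_ratio_Suc field_simps)
  finally show ?case .
qed

section \<open>Size of the coefficients: convergence below 1/16, divergence at 1/16\<close>

text \<open>The product starts at 1 and does not increase, since (2n+1)(2n+3) \<le>
  (2n+2)^2.\<close>

lemma central_binom_ratio_sq_upper: "(central_binom_ratio n)\<^sup>2 * (2 * real n + 1) \<le> 1"
proof (induction n)
  case (Suc n)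
  have "(central_binom_ratio (Suc n))\<^sup>2 * (2 * real (Suc n) + 1)
      = ((central_binom_ratio n)\<^sup>2 * (2 * real n + 1)) *
        ((2 * real n + 1) * (2 * real n + 3) / (2 * real n + 2)\<^sup>2)"
    by (simp add: central_binom_ratio_Suc power_mult_distrib power_divide divide_simps)
       (simp add: power2_eq_square algebra_simps)
  also have "\<dots> \<le> 1 * 1"
  proof (intro mult_mono Suc.IH)
    show "(2 * real n + 1) * (2 * real n + 3) / (2 * real n + 2)\<^sup>2 \<le> 1"
      by (subst divide_le_eq_1_pos) (auto simp: power2_eq_square algebra_simps intro!: add_pos_nonneg)
  qed auto
  finally show ?case by simp
qed auto

text \<open>The product equals 1/4 at n = 1 and does not decrease, since 4n(n+1) \<le> (2n+1)^2. The
  resulting bound 1/(4n) allows comparison with the harmonic series at t = 1/16.\<close>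

lemma central_binom_ratio_sq_lower:
  "n > 0 \<Longrightarrow> 1 / 4 \<le> (central_binom_ratio n)\<^sup>2 * real n"
proof (induction n rule: nat_induct_non_zero)
  case 1
  have "central_binom_ratio (Suc 0) = 1 / 2" by (simp add: central_binom_ratio_Suc)
  thus ?case unfolding One_nat_def by (simp only:) (simp add: power2_eq_square)
next
  case (Suc n)
  have "(central_binom_ratio n)\<^sup>2 * real n * 1
      \<le> ((central_binom_ratio n)\<^sup>2 * real n) * ((2 * real n + 1)\<^sup>2 / (4 * real n * (real n + 1)))"
  proof (intro mult_left_mono)
    show "1 \<le> (2 * real n + 1)\<^sup>2 / (4 * real n * (real n + 1))"
      using Suc.hyps by (subst le_divide_eq_1_pos) (auto simp: power2_eq_square algebra_simps intro!: add_pos_nonneg)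
  qed auto
  also have "\<dots> = (central_binom_ratio (Suc n))\<^sup>2 * real (Suc n)"
    using Suc.hyps
    by (simp add: central_binom_ratio_Suc power_mult_distrib power_divide divide_simps)
       (simp add: power2_eq_square algebra_simps)
  finally show ?case using Suc.IH by simp
qed

lemma central_binom_sq_eq: "central_binom_sq n = (central_binom_ratio n)\<^sup>2 * 16 ^ n"
proof -
  have "(16::real) ^ n = (4 ^ n)\<^sup>2"
    by (simp add: power2_eq_square flip: power_mult_distrib)
  thus ?thesis
    by (simp add: central_binom_sq_def central_binom_ratio_def power_divide)
qed

lemma central_binom_sq_mult_power: "central_binom_sq n * t ^ n = (central_binom_ratio n)\<^sup>2 * (16 * t) ^ n"
  by (simp add: central_binom_sq_eq power_mult_distrib)

lemma summable_central_binom_sq: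
  assumes "0 \<le> t" "t < 1 / 16"
  shows "summable (\<lambda>n. central_binom_sq n * t ^ n)"
proof (rule summable_comparison_test')
  show "summable (\<lambda>n. (16 * t) ^ n)" using assms by (intro summable_geometric) auto
  fix n :: nat assume "n \<ge> 0"
  have "(central_binom_ratio n)\<^sup>2 * 1 \<le> (central_binom_ratio n)\<^sup>2 * (2 * real n + 1)"
    by (intro mult_left_mono) auto
  with central_binom_ratio_sq_upper[of n] have "(central_binom_ratio n)\<^sup>2 \<le> 1" by linarith
  thus "norm (central_binom_sq n * t ^ n) \<le> (16 * t) ^ n"
    using assms unfolding central_binom_sq_mult_power
    by (simp add: abs_mult mult_left_le_one_le)
qed

lemma not_summable_central_binom_sq: "\<not> summable (\<lambda>n. central_binom_sq n * (1 / 16) ^ n)"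
proof
  assume "summable (\<lambda>n. central_binom_sq n * (1 / 16) ^ n)"
  hence "summable (\<lambda>n. 4 * (central_binom_ratio n)\<^sup>2)"
    unfolding central_binom_sq_mult_power by (intro summable_mult) simp
  hence "summable (\<lambda>n. inverse (real n))"
  proof (rule summable_comparison_test'[where N = 1])
    fix n :: nat assume "n \<ge> 1"
    thus "norm (inverse (real n)) \<le> 4 * (central_binom_ratio n)\<^sup>2"
      using central_binom_ratio_sq_lower[of n] by (simp add: field_simps)
  qed
  thus False using not_summable_harmonic[where 'a = real] by simp
qed

lemma genfun_eq_elliptic_K:
  assumes "0 \<le> t" "t < 1 / 16"
  shows "genfun t = 2 / pi * elliptic_K (16 * t)"
proof -
  define z where "z = 16 * t"
  have z: "0 \<le> z" "z < 1" using assms by (auto simp: z_def)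
  define f where "f = (\<lambda>k x::real. \<Sum>n<k. central_binom_ratio n * z ^ n * (x ^ (2 * n) / sqrt (1 - x\<^sup>2)))"
  have f_int: "(f k has_integral (pi / 2 * (\<Sum>n<k. central_binom_sq n * t ^ n))) {0..1}" for k
  proof -
    have "(f k has_integral (\<Sum>n<k. central_binom_ratio n * z ^ n * (pi / 2 * central_binom_ratio n))) {0..1}"
      unfolding f_def by (intro has_integral_sum has_integral_mult_right has_integral_even_power_arcsine) auto
    thus ?thesis
      by (simp add: sum_distrib_left central_binom_sq_mult_power z_def power2_eq_square mult_ac)
  qed
  have f_eq: "integral {0..1} (f k) = pi / 2 * (\<Sum>n<k. central_binom_sq n * t ^ n)" for k
    using f_int by (rule integral_unique)
  have sum_lim: "(\<lambda>k. pi / 2 * (\<Sum>n<k. central_binom_sq n * t ^ n)) \<longlonglongrightarrow> pi / 2 * genfun t"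
    unfolding genfun_def by (intro tendsto_mult tendsto_const summable_LIMSEQ summable_central_binom_sq assms)
  have "(\<lambda>k. integral {0..1} (f k)) \<longlonglongrightarrow> integral {0..1} (\<lambda>x. 1 / sqrt ((1 - x\<^sup>2) * (1 - z * x\<^sup>2)))"
  proof (rule conjunct2[OF monotone_convergence_increasing])
    show "f k integrable_on {0..1}" for k using f_int by blast
    show "f k x \<le> f (Suc k) x" if "x \<in> {0..1}" for k x
      using that z by (auto simp: f_def abs_square_le_1 less_imp_le[OF central_binom_ratio_pos])
    \<comment> \<open>At x = 1 the common factor \<open>1 / sqrt (1 - x\<^sup>2)\<close> is 1 / 0 =
      0, so the partial sums and the limit all vanish and the same argument covers the
      endpoint.\<close>
    show "(\<lambda>k. f k x) \<longlonglongrightarrow> 1 / sqrt ((1 - x\<^sup>2) * (1 - z * x\<^sup>2))" if x: "x \<in> {0..1}" for x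
    proof -
      have "z * x\<^sup>2 \<le> z * 1" using x z by (intro mult_left_mono) (auto simp: abs_square_le_1)
      hence "\<bar>z * x\<^sup>2\<bar> < 1" using z by simp
      hence "(\<lambda>n. central_binom_ratio n * (z * x\<^sup>2) ^ n * (1 / sqrt (1 - x\<^sup>2))) sums
               (1 / sqrt (1 - z * x\<^sup>2) * (1 / sqrt (1 - x\<^sup>2)))"
        by (intro sums_mult2 inverse_sqrt_series)
      moreover have "central_binom_ratio n * (z * x\<^sup>2) ^ n * (1 / sqrt (1 - x\<^sup>2))
          = central_binom_ratio n * z ^ n * (x ^ (2 * n) / sqrt (1 - x\<^sup>2))" for n
        by (simp add: power_mult_distrib flip: power_mult)
      moreover have "1 / sqrt (1 - z * x\<^sup>2) * (1 / sqrt (1 - x\<^sup>2)) = 1 / sqrt ((1 - x\<^sup>2) * (1 - z * x\<^sup>2))"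
        by (simp add: real_sqrt_mult)
      ultimately show ?thesis
        by (simp only: sums_def f_def)
    qed
    show "bounded (range (\<lambda>k. integral {0..1} (f k)))"
      unfolding f_eq by (rule convergent_imp_bounded[OF sum_lim])
  qed
  hence "elliptic_K z = pi / 2 * genfun t"
    using sum_lim unfolding f_eq elliptic_K_def by (rule LIMSEQ_unique)
  thus ?thesis by (simp add: z_def divide_simps mult_ac)
qed

section \<open>Moments of the tilted coefficients\<close>

context
  fixes c :: "nat \<Rightarrow> real" and R :: real
  assumes summable_c: "\<And>t. 0 \<le> t \<Longrightarrow> t < R \<Longrightarrow> summable (\<lambda>n. c n * t ^ n)"
begin

text \<open>Convergence at a point strictly between |t| and R carries over to arguments of either
  sign.\<close>

lemma summable_powser_abs: 
  assumes "\<bar>t\<bar> < R" shows "summable (\<lambda>n. c n * t ^ n)"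
proof -
  define r where "r = (\<bar>t\<bar> + R) / 2"
  have "\<bar>t\<bar> < r" "r < R" "0 \<le> r" using assms by (auto simp: r_def)
  thus ?thesis using powser_inside[of c r t] summable_c[of r] by auto
qed

text \<open>The operator t d/dt multiplies the n-th coefficient by n without shifting exponents, so
  iterating it produces moments.\<close>

lemma euler_powser:
  assumes "\<bar>t\<bar> < R"
  shows "(\<lambda>n. real n * c n * t ^ n) sums (t * (\<Sum>n. diffs c n * t ^ n))"
proof -
  have "summable (\<lambda>n. diffs c n * t ^ n)"
    using assms summable_powser_abs by (intro termdiff_converges[of t R]) auto
  from sums_mult[OF diffs_equiv[OF this], of t]
  have "(\<lambda>n. t * (real n * c n * t ^ (n - Suc 0))) sums (t * (\<Sum>n. diffs c n * t ^ n))"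
    by simp
  also have "(\<lambda>n. t * (real n * c n * t ^ (n - Suc 0))) = (\<lambda>n. real n * c n * t ^ n)"
  proof
    \<comment> \<open>At n = 0 the truncated exponent is harmless because the factor
      \<open>real n\<close> vanishes.\<close>
    show "t * (real n * c n * t ^ (n - Suc 0)) = real n * c n * t ^ n" for n
      by (cases n) auto
  qed
  finally show ?thesis .
qed

lemma summable_euler_powser:
  assumes "\<bar>t\<bar> < R" shows "summable (\<lambda>n. real n * c n * t ^ n)"
  using euler_powser[OF assms] by (rule sums_summable)

lemma DERIV_powser_euler:
  assumes "0 < t" "t < R"
  shows "((\<lambda>t. \<Sum>n. c n * t ^ n) has_real_derivative (\<Sum>n. real n * c n * t ^ n) / t) (at t)"
proof -
  have "((\<lambda>t. \<Sum>n. c n * t ^ n) has_real_derivative (\<Sum>n. diffs c n * t ^ n)) (at t)"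
    using assms summable_powser_abs by (intro termdiffs_strong'[of R]) auto
  moreover have "(\<Sum>n. real n * c n * t ^ n) / t = (\<Sum>n. diffs c n * t ^ n)"
    using euler_powser[of t] assms by (simp add: sums_iff)
  ultimately show ?thesis by simp
qed

text \<open>Fills the gap at 0 left by the division by t in \<open>DERIV_powser_euler\<close>; the
  intermediate value argument for the mean starts there.\<close>

lemma isCont_powser_zero:
  assumes "0 < R"
  shows "isCont (\<lambda>t. \<Sum>n. c n * t ^ n) 0"
  using assms summable_powser_abs by (intro DERIV_isCont[OF termdiffs_strong'[of R]]) auto

end

section \<open>The tilted distribution, its mean and its variance\<close>

text \<open>Positive mass at 0 and 1 makes the distribution nondegenerate. As these are adjacent
  integers, it also keeps the characteristic function below 1 in modulus away from 0 on
  [-pi, pi].\<close>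

locale coeff_series =
  fixes a :: "nat \<Rightarrow> real" and R :: real
  assumes a_nonneg: "a n \<ge> 0"
    and a0_pos: "a 0 > 0"
    and a1_pos: "a 1 > 0"
    and R_pos: "R > 0"
    and summable_a: "0 \<le> t \<Longrightarrow> t < R \<Longrightarrow> summable (\<lambda>n. a n * t ^ n)"
begin

definition moment :: "nat \<Rightarrow> real \<Rightarrow> real" where
  "moment j t = (\<Sum>n. real n ^ j * a n * t ^ n)"

definition mean :: "real \<Rightarrow> real" where
  "mean t = moment 1 t / moment 0 t"

definition var :: "real \<Rightarrow> real" where
  "var t = moment 2 t / moment 0 t - (mean t)\<^sup>2"

lemma summable_moment:
  assumes "0 \<le> t" "t < R"
  shows "summable (\<lambda>n. real n ^ j * a n * t ^ n)"
  using assms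
proof (induction j arbitrary: t)
  case 0
  thus ?case using summable_a by simp
next
  case (Suc j)
  have "summable (\<lambda>n. real n * (real n ^ j * a n) * t ^ n)"
    using Suc by (intro summable_euler_powser[of R]) auto
  thus ?case by (simp add: mult_ac)
qed

lemma DERIV_moment:
  assumes "0 < t" "t < R"
  shows "(moment j has_real_derivative moment (Suc j) t / t) (at t)"
proof -
  have "((\<lambda>t. \<Sum>n. (real n ^ j * a n) * t ^ n) has_real_derivative
          (\<Sum>n. real n * (real n ^ j * a n) * t ^ n) / t) (at t)"
    by (rule DERIV_powser_euler[OF summable_moment assms])
  thus ?thesis by (simp add: moment_def[abs_def] mult_ac)
qed

lemma isCont_moment:
  assumes "0 \<le> t" "t < R"
  shows "isCont (moment j) t"
proof (cases "t = 0")
  case True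
  show ?thesis unfolding True moment_def[abs_def]
    by (rule isCont_powser_zero[OF summable_moment R_pos])
qed (use assms DERIV_moment[of t j] in \<open>auto intro: DERIV_isCont\<close>)

lemma moment_nonneg: "0 \<le> t \<Longrightarrow> t < R \<Longrightarrow> moment j t \<ge> 0"
  unfolding moment_def using a_nonneg by (intro suminf_nonneg summable_moment) auto

lemma moment_0_pos:
  assumes "0 \<le> t" "t < R"
  shows "moment 0 t > 0"
  unfolding moment_def
  using a_nonneg a0_pos assms by (intro suminf_pos2[of _ 0] summable_moment) auto

lemma moment_0_ge:
  assumes "0 \<le> t" "t < R"
  shows "(\<Sum>n<N. a n * t ^ n) \<le> moment 0 t"
  unfolding moment_def
  using a_nonneg assms sum_le_suminf[OF summable_moment[of t 0], of "{..<N}"] by simp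

lemma moment_1_pos:
  assumes "0 < t" "t < R"
  shows "moment 1 t > 0"
  unfolding moment_def
  using a_nonneg a1_pos assms by (intro suminf_pos2[of _ 1] summable_moment) auto

definition weight :: "real \<Rightarrow> nat \<Rightarrow> real" where
  "weight t n = a n * t ^ n / moment 0 t"

lemma weight_nonneg: "0 \<le> t \<Longrightarrow> t < R \<Longrightarrow> weight t n \<ge> 0"
  using a_nonneg moment_0_pos[of t] by (simp add: weight_def)

lemma weight_moment_sums:
  assumes "0 \<le> t" "t < R"
  shows "(\<lambda>n. real n ^ j * weight t n) sums (moment j t / moment 0 t)"
proof -
  have "(\<lambda>n. real n ^ j * a n * t ^ n / moment 0 t) sums (moment j t / moment 0 t)"
    unfolding moment_def[of j] by (intro sums_divide summable_sums summable_moment assms)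
  thus ?thesis by (simp add: weight_def mult.assoc)
qed

lemma weight_sums: "0 \<le> t \<Longrightarrow> t < R \<Longrightarrow> weight t sums 1"
  using weight_moment_sums[of t 0] moment_0_pos[of t] by simp

lemma weight_mean_sums: "0 \<le> t \<Longrightarrow> t < R \<Longrightarrow> (\<lambda>n. real n * weight t n) sums mean t"
  using weight_moment_sums[of t 1] by (simp add: mean_def)

lemma weight_centred_sums:
  assumes "0 \<le> t" "t < R"
  shows "(\<lambda>n. weight t n * (real n - mean t)) sums 0"
proof -
  have "(\<lambda>n. real n * weight t n - mean t * weight t n) sums (mean t - mean t * 1)"
    by (intro sums_diff sums_mult weight_sums weight_mean_sums assms)
  thus ?thesis by (simp add: algebra_simps)
qed

lemma weight_var_sums:
  assumes "0 \<le> t" "t < R"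
  shows "(\<lambda>n. weight t n * (real n - mean t)\<^sup>2) sums var t"
proof -
  have "(\<lambda>n. real n ^ 2 * weight t n - 2 * mean t * (real n * weight t n) + (mean t)\<^sup>2 * weight t n) sums
          (moment 2 t / moment 0 t - 2 * mean t * mean t + (mean t)\<^sup>2 * 1)"
    by (intro sums_add sums_diff sums_mult weight_sums weight_mean_sums weight_moment_sums assms)
  thus ?thesis by (simp add: algebra_simps power2_eq_square var_def)
qed

text \<open>The terms of the variance series are nonnegative, and the one at n = 0 is positive
  because the mean is.\<close>

lemma var_pos:
  assumes "0 < t" "t < R"
  shows "var t > 0"
proof -
  have "mean t > 0" using assms moment_1_pos moment_0_pos[of t] by (simp add: mean_def)
  moreover have "weight t 0 > 0" using assms a0_pos moment_0_pos[of t] by (simp add: weight_def)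
  ultimately have "(\<Sum>n. weight t n * (real n - mean t)\<^sup>2) > 0"
    using assms weight_var_sums[of t] weight_nonneg[of t]
    by (intro suminf_pos2[of _ 0]) (auto simp: sums_iff)
  thus ?thesis using assms weight_var_sums[of t] by (simp add: sums_iff)
qed

lemma DERIV_mean:
  assumes "0 < t" "t < R"
  shows "(mean has_real_derivative var t / t) (at t)"
proof -
  have pos: "moment 0 t > 0" using assms by (intro moment_0_pos) auto
  have "(mean has_real_derivative
     (moment (Suc 1) t / t * moment 0 t - moment 1 t * (moment (Suc 0) t / t)) / (moment 0 t * moment 0 t)) (at t)"
    unfolding mean_def[abs_def]
    using pos by (intro DERIV_divide DERIV_moment assms) auto
  also have "(moment (Suc 1) t / t * moment 0 t - moment 1 t * (moment (Suc 0) t / t)) / (moment 0 t * moment 0 t) = var t / t"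
    using pos assms unfolding var_def mean_def
    by (simp add: field_simps power2_eq_square numeral_2_eq_2)
  finally show ?thesis .
qed

lemma isCont_mean: "0 \<le> t \<Longrightarrow> t < R \<Longrightarrow> isCont mean t"
  unfolding mean_def[abs_def] using moment_0_pos[of t]
  by (intro continuous_intros isCont_moment) auto

lemma isCont_var: "0 \<le> t \<Longrightarrow> t < R \<Longrightarrow> isCont var t"
  unfolding var_def[abs_def] using moment_0_pos[of t]
  by (intro continuous_intros isCont_moment isCont_mean) auto

lemma mean_strict_mono:
  assumes "0 < s" "s < t" "t < R"
  shows "mean s < mean t"
proof (rule DERIV_pos_imp_increasing[OF assms(2)])
  fix x assume "s \<le> x" "x \<le> t"
  hence "0 < x" "x < R" using assms by auto
  thus "\<exists>y. (mean has_real_derivative y) (at x) \<and> y > 0"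
    using DERIV_mean[of x] var_pos[of x] by (intro exI[of _ "var x / x"]) auto
qed

lemma DERIV_ln_moment_0:
  assumes "0 < t" "t < R"
  shows "((\<lambda>s. ln (moment 0 s)) has_real_derivative mean t / t) (at t)"
proof -
  have "((\<lambda>s. ln (moment 0 s)) has_real_derivative 1 / moment 0 t * (moment (Suc 0) t / t)) (at t)"
    using assms moment_0_pos[of t] by (intro DERIV_ln_divide[THEN DERIV_chain2] DERIV_moment) auto
  thus ?thesis by (simp add: mean_def)
qed

text \<open>The left side is t d/dt applied twice to \<open>ln (moment 0 t)\<close>; the first
  application gives the mean, and the second gives t times its derivative, the variance.\<close>

lemma var_eq_log_derivatives:
  assumes "0 < t" "t < R"
  shows "t * deriv (\<lambda>s. ln (moment 0 s)) t + t\<^sup>2 * deriv (deriv (\<lambda>s. ln (moment 0 s))) t = var t"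
proof -
  let ?L = "\<lambda>s. ln (moment 0 s)"
  have D1: "deriv ?L s = mean s / s" if "0 < s" "s < R" for s
    using DERIV_ln_moment_0[OF that] by (rule DERIV_imp_deriv)
  have "((\<lambda>s. mean s / s) has_real_derivative (var t / t * t - mean t * 1) / (t * t)) (at t)"
    using assms by (intro DERIV_divide DERIV_mean DERIV_ident) auto
  \<comment> \<open>The formula for \<open>deriv ?L\<close> holds on the open interval around t,
    which suffices to differentiate it at t.\<close>
  hence "(deriv ?L has_real_derivative (var t / t * t - mean t * 1) / (t * t)) (at t)"
  proof (rule has_field_derivative_transform_within_open)
    show "open {0<..<R}" "t \<in> {0<..<R}" using assms by auto
  qed (auto simp: D1)
  hence "deriv (deriv ?L) t = (var t - mean t) / (t * t)"
    using assms by (simp add: DERIV_imp_deriv)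
  thus ?thesis using assms by (simp add: D1 field_simps power2_eq_square)
qed

end

section \<open>Range of the mean and location of the minimizer\<close>

locale divergent_coeff_series = coeff_series +
  assumes not_summable_R: "\<not> summable (\<lambda>n. a n * R ^ n)"
begin

text \<open>A bound on (0, R) would bound every partial sum there, and by continuity of polynomials
  also at R; nonnegative terms would then be summable at R.\<close>

lemma moment_0_unbounded: "\<exists>t. 0 < t \<and> t < R \<and> moment 0 t > B"
proof (rule ccontr)
  assume "\<not> ?thesis"
  hence le: "moment 0 t \<le> B" if "0 < t" "t < R" for t using that by force
  have "(\<Sum>n<N. a n * R ^ n) \<le> B" for N
  proof (rule tendsto_upperbound)
    show "((\<lambda>t. \<Sum>n<N. a n * t ^ n) \<longlongrightarrow> (\<Sum>n<N. a n * R ^ n)) (at_left R)"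
      by (intro tendsto_intros)
    have "eventually (\<lambda>t. t \<in> {0<..<R}) (at_left R)"
      using R_pos by (intro eventually_at_left_real) auto
    thus "eventually (\<lambda>t. (\<Sum>n<N. a n * t ^ n) \<le> B) (at_left R)"
    proof eventually_elim
      case (elim t)
      thus ?case using moment_0_ge[of t N] le[of t] by force
    qed
  qed auto
  hence "summable (\<lambda>n. a n * R ^ n)"
    using a_nonneg R_pos by (intro bounded_imp_summable[where B = B])
      (auto simp: lessThan_Suc_atMost[symmetric] simp del: sum.lessThan_Suc)
  with not_summable_R show False by simp
qed

text \<open>Splitting the series at \<open>2 M\<close> gives \<open>moment 1 - M * moment 0 \<ge> M * moment 0 - C\<close>, where
  \<open>C\<close> bounds the finitely many terms below the split.\<close>

lemma mean_unbounded: "\<exists>t. 0 < t \<and> t < R \<and> mean t > M"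
proof -
  define m where "m = nat \<lceil>max M 1\<rceil>"
  have m: "M \<le> real m" "1 \<le> m" unfolding m_def by linarith+
  \<comment> \<open>Using \<open>R ^ n\<close> in place of \<open>t ^ n\<close> makes
    \<open>C\<close> independent of t, so t can be chosen afterwards.\<close>
  define C where "C = (\<Sum>n<2*m. 2 * real m * (a n * R ^ n))"
  obtain t where t: "0 < t" "t < R" "moment 0 t > C" using moment_0_unbounded by blast
  have g: "moment 0 t > 0" using t by (intro moment_0_pos) auto
  have C: "C \<ge> 0" unfolding C_def using a_nonneg R_pos by (intro sum_nonneg) auto
  have S: "(\<lambda>n. (real n - 2 * real m) * (a n * t ^ n)) sums (moment 1 t - 2 * real m * moment 0 t)"
  proof -
    have "(\<lambda>n. real n ^ 1 * a n * t ^ n - 2 * real m * (real n ^ 0 * a n * t ^ n)) sums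
        (moment 1 t - 2 * real m * moment 0 t)"
      unfolding moment_def using t by (intro sums_diff sums_mult summable_sums summable_moment) auto
    thus ?thesis by (simp add: algebra_simps)
  qed
  have "- C \<le> (\<Sum>n<2*m. (real n - 2 * real m) * (a n * t ^ n))"
  proof -
    have "- (2 * real m * (a n * R ^ n)) \<le> (real n - 2 * real m) * (a n * t ^ n)" for n
    proof -
      have "a n * t ^ n \<le> a n * R ^ n" using t by (intro mult_left_mono power_mono a_nonneg) auto
      hence "2 * real m * (a n * t ^ n) \<le> 2 * real m * (a n * R ^ n)" by (rule mult_left_mono) auto
      moreover have "0 \<le> real n * (a n * t ^ n)" using t a_nonneg by auto
      ultimately show ?thesis by (simp add: algebra_simps)
    qed
    thus ?thesis unfolding C_def sum_negf[symmetric] by (rule sum_mono)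
  qed
  also have "\<dots> \<le> (\<Sum>n. (real n - 2 * real m) * (a n * t ^ n))"
    using S t a_nonneg by (intro sum_le_suminf) (auto simp: sums_iff intro!: mult_nonneg_nonneg)
  also have "\<dots> = moment 1 t - 2 * real m * moment 0 t" using S by (simp add: sums_iff)
  finally have "moment 1 t \<ge> real m * moment 0 t + (real m * moment 0 t - C)" by simp
  moreover have "1 * moment 0 t \<le> real m * moment 0 t" using m g by (intro mult_right_mono) auto
  ultimately have "moment 1 t > real m * moment 0 t" using t(3) by linarith
  hence "mean t > real m" using g by (simp add: mean_def field_simps)
  with t m show ?thesis by (intro exI[of _ t]) auto
qed

text \<open>Intermediate value theorem between 0, where the mean is 0, and a point where it exceeds
  the target.\<close>

lemma mean_surj:
  assumes "\<mu> > 0"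
  shows "\<exists>t. 0 < t \<and> t < R \<and> mean t = \<mu>"
proof -
  obtain s where s: "0 < s" "s < R" "mean s > \<mu>" using mean_unbounded by blast
  have "moment 1 0 = 0" by (simp add: moment_def powser_zero)
  hence m0: "mean 0 = 0" by (simp add: mean_def)
  have "\<exists>t. 0 \<le> t \<and> t \<le> s \<and> mean t = \<mu>"
    using assms s m0 by (intro IVT allI impI isCont_mean) auto
  then obtain t where t: "0 \<le> t" "t \<le> s" "mean t = \<mu>" by blast
  with m0 assms have "t \<noteq> 0" by auto
  with t s show ?thesis by (intro exI[of _ t]) auto
qed

text \<open>The derivative has the sign of \<open>\<kappa> * mean s - 1\<close>. As the mean is
  strictly increasing, the function falls strictly before the root \<open>u\<close> and rises
  strictly after it.\<close>

lemma arg_min_iff_mean: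
  assumes "\<kappa> > 0"
  shows "is_arg_min (\<lambda>s. \<kappa> * ln (moment 0 s) - ln s) (\<lambda>s. s \<in> {0<..<R}) t \<longleftrightarrow>
         0 < t \<and> t < R \<and> \<kappa> * mean t = 1"
proof -
  let ?f = "\<lambda>s. \<kappa> * ln (moment 0 s) - ln s"
  have D: "(?f has_real_derivative (\<kappa> * mean s - 1) / s) (at s)" if "0 < s" "s < R" for s
  proof -
    have "(?f has_real_derivative \<kappa> * (mean s / s) - 1 / s) (at s)"
      using that by (intro DERIV_diff DERIV_cmult DERIV_ln_moment_0 DERIV_ln_divide) auto
    thus ?thesis by (simp add: diff_divide_distrib)
  qed
  obtain u where u: "0 < u" "u < R" "mean u = 1 / \<kappa>" using mean_surj[of "1 / \<kappa>"] assms by auto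
  have less: "?f u < ?f s" if s: "0 < s" "s < R" "s \<noteq> u" for s
  proof (cases "s < u")
    case True
    show ?thesis
    proof (rule DERIV_neg_imp_decreasing_open[OF True])
      fix x assume x: "s < x" "x < u"
      hence "mean x < mean u" using s u by (intro mean_strict_mono) auto
      hence "\<kappa> * mean x < 1" using u assms by (simp add: field_simps)
      thus "\<exists>y. (?f has_real_derivative y) (at x) \<and> y < 0"
        using D[of x] x s u by (intro exI[of _ "(\<kappa> * mean x - 1) / x"]) (auto simp: field_simps)
    next
      show "continuous_on {s..u} ?f"
        using s u by (intro continuous_at_imp_continuous_on ballI DERIV_isCont[OF D]) auto
    qed
  next
    case False
    with s have us: "u < s" by simp
    show ?thesis
    proof (rule DERIV_pos_imp_increasing_open[OF us])
      fix x assume x: "u < x" "x < s"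
      hence "mean u < mean x" using s u by (intro mean_strict_mono) auto
      hence "\<kappa> * mean x > 1" using u assms by (simp add: field_simps)
      thus "\<exists>y. (?f has_real_derivative y) (at x) \<and> y > 0"
        using D[of x] x s u by (intro exI[of _ "(\<kappa> * mean x - 1) / x"]) (auto simp: field_simps)
    next
      show "continuous_on {u..s} ?f"
        using s u by (intro continuous_at_imp_continuous_on ballI DERIV_isCont[OF D]) auto
    qed
  qed
  have eq: "t = u" if "0 < t" "t < R" "\<kappa> * mean t = 1"
  proof -
    have "mean t = 1 / \<kappa>" using assms that by (simp add: field_simps)
    thus ?thesis using mean_strict_mono[of t u] mean_strict_mono[of u t] that u(1,2) unfolding u(3)[symmetric] by linarith
  qed
  show ?thesis
  proof
    assume "is_arg_min ?f (\<lambda>s. s \<in> {0<..<R}) t"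
    hence "0 < t" "t < R" "\<not> ?f u < ?f t" using u by (auto simp: is_arg_min_def)
    hence "t = u" using less[of t] by auto
    thus "0 < t \<and> t < R \<and> \<kappa> * mean t = 1" using u assms by simp
  next
    assume t: "0 < t \<and> t < R \<and> \<kappa> * mean t = 1"
    hence "t = u" using eq by blast
    thus "is_arg_min ?f (\<lambda>s. s \<in> {0<..<R}) t" using u less
      by (force simp: is_arg_min_def)
  qed
qed

text \<open>Continuity of the inverse of the mean, by monotonicity: a level \<open>l\<close> in (0,
  R) on one side of \<open>u\<close> is separated from it by the means, hence eventually also from
  \<open>t n\<close>. Levels outside (0, R) are separated by the range of
  \<open>t n\<close>.\<close>

lemma mean_eq_tendsto:
  assumes t: "\<forall>\<^sub>F n in F. 0 < t n \<and> t n < R" and u: "0 < u" "u < R"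
    and lim: "((\<lambda>n. mean (t n)) \<longlongrightarrow> mean u) F"
  shows "(t \<longlongrightarrow> u) F"
proof (rule order_tendstoI)
  fix l assume l: "l < u"
  show "\<forall>\<^sub>F n in F. l < t n"
  proof (cases "0 < l")
    case True
    hence "mean l < mean u" using l u by (intro mean_strict_mono) auto
    with lim have "\<forall>\<^sub>F n in F. mean l < mean (t n)" by (rule order_tendstoD)
    with t show ?thesis
    proof eventually_elim
      case (elim n)
      thus ?case using mean_strict_mono[of "t n" l] True l u by (cases "t n" l rule: linorder_cases) auto
    qed
  qed (use t in \<open>auto elim!: eventually_mono\<close>)
next
  fix l assume l: "u < l"
  show "\<forall>\<^sub>F n in F. t n < l"
  proof (cases "l < R")
    case True
    hence "mean u < mean l" using l u by (intro mean_strict_mono) auto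
    with lim have "\<forall>\<^sub>F n in F. mean (t n) < mean l" by (rule order_tendstoD)
    with t show ?thesis
    proof eventually_elim
      case (elim n)
      thus ?case using mean_strict_mono[of l "t n"] True l u by (cases "t n" l rule: linorder_cases) auto
    qed
  qed (use t in \<open>auto elim!: eventually_mono\<close>)
qed

end

section \<open>Local central limit theorem\<close>

text \<open>The same tuples index the convolution and the coefficient of a power of a formal power
  series; the complex embedding prepares for evaluation on a circle.\<close>

lemma of_real_conv_power:
  "of_real (conv_power a k n) = fps_nth (Abs_fps (\<lambda>n. of_real (a n) :: complex) ^ k) n"
proof (cases k)
  case 0
  have "{js :: nat list. length js = 0 \<and> sum_list js = n} = (if n = 0 then {[]} else {})"
    by auto
  with 0 show ?thesis unfolding conv_power_def by simp
next
  case (Suc m)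
  thus ?thesis
    by (simp only: conv_power_def natpermute_def if_False nat.distinct fps_power_nth)
       (simp add: atLeast0AtMost lessThan_Suc_atMost)
qed

text \<open>Jordan's inequality: the concave sine lies above its chord from 0 to pi / 2.\<close>

lemma sin_ge_linear:
  assumes "0 \<le> x" "x \<le> pi / 2"
  shows "2 * x / pi \<le> sin x"
proof -
  have "concave_on {0..pi} sin"
    by (rule f''_le0_imp_concave[where f' = cos and f'' = "\<lambda>x. - sin x"])
       (auto intro!: derivative_eq_intros sin_ge_zero)
  from concave_onD[OF this, of "2 * x / pi" 0 "pi / 2"] assms
  show ?thesis by (simp add: field_simps)
qed

text \<open>Half-angle formula and Jordan's inequality. The quadratic bound covers the whole range
  of the Fourier integral.\<close>

lemma one_minus_cos_ge:
  assumes "\<bar>\<theta>\<bar> \<le> pi"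
  shows "2 / pi\<^sup>2 * \<theta>\<^sup>2 \<le> 1 - cos \<theta>"
proof -
  have "2 * (\<bar>\<theta>\<bar> / 2) / pi \<le> sin (\<bar>\<theta>\<bar> / 2)"
    using assms by (intro sin_ge_linear) auto
  hence "(\<bar>\<theta>\<bar> / pi)\<^sup>2 \<le> (sin (\<bar>\<theta>\<bar> / 2))\<^sup>2"
    by (intro power_mono) auto
  moreover have "1 - cos \<theta> = 2 * (sin (\<bar>\<theta>\<bar> / 2))\<^sup>2"
    using cos_double_sin[of "\<bar>\<theta>\<bar> / 2"] by simp
  ultimately show ?thesis by (simp add: power_divide)
qed

text \<open>From above, exp(-y) \<le> 1/(1+y) \<le> 1 - y + y^2, the latter because (1+y)(1-y+y^2) =
  1 + y^3.\<close>

lemma abs_exp_minus_linear_le: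
  fixes y :: real
  assumes "0 \<le> y"
  shows "\<bar>exp (- y) - (1 - y)\<bar> \<le> y\<^sup>2"
proof -
  have "exp (- y) \<le> 1 / (1 + y)"
    using exp_ge_add_one_self[of y] assms by (simp add: exp_minus field_simps)
  also have "\<dots> \<le> 1 - y + y\<^sup>2"
    using assms by (subst pos_divide_le_eq) (auto simp: algebra_simps power2_eq_square)
  finally show ?thesis using exp_minus_ge[of y] by simp
qed

lemma integral_exp_minus_square:
  assumes "b > 0"
  shows "integrable lborel (\<lambda>x::real. exp (- b * x\<^sup>2))"
    and "(\<integral>x. exp (- b * x\<^sup>2) \<partial>lborel) = sqrt (pi / b)"
proof -
  \<comment> \<open>The variance for which the normal density has exponent -b x^2.\<close>
  define \<sigma> where "\<sigma> = sqrt (1 / (2 * b))"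
  have \<sigma>: "\<sigma>\<^sup>2 = 1 / (2 * b)" "\<sigma> > 0" using assms by (auto simp: \<sigma>_def)
  have eq: "exp (- b * x\<^sup>2) = sqrt (pi / b) * normal_density 0 \<sigma> x" for x
    using assms by (simp add: normal_density_def \<sigma>(1))
  show "integrable lborel (\<lambda>x::real. exp (- b * x\<^sup>2))"
    unfolding eq using \<sigma>(2) by (intro integrable_mult_right integrable_normal_density)
  show "(\<integral>x. exp (- b * x\<^sup>2) \<partial>lborel) = sqrt (pi / b)"
    unfolding eq using \<sigma>(2) by simp
qed

text \<open>Orthogonality of the characters: for nonzero integer j the primitive takes equal values
  at -pi and pi.\<close>

lemma integral_cis:
  fixes j :: int
  shows "(\<integral>\<theta>. indicator {-pi..pi} \<theta> *\<^sub>R cis (of_int j * \<theta>) \<partial>lborel) = (if j = 0 then 2 * pi else 0)"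
proof (cases "j = 0")
  case False
  define c where "c = \<i> * of_int j"
  have c: "c \<noteq> 0" using False by (simp add: c_def)
  have cis_eq: "cis (of_int j * x) = exp (c * of_real x)" for x
    by (simp add: cis_conv_exp c_def mult.assoc)
  have "(\<integral>\<theta>. indicator {-pi..pi} \<theta> *\<^sub>R cis (of_int j * \<theta>) \<partial>lborel)
      = exp (c * of_real pi) / c - exp (c * of_real (-pi)) / c"
    unfolding cis_eq
  proof (rule integral_FTC_Icc)
    fix x :: real
    have "((\<lambda>z. exp (c * z) / c) has_field_derivative exp (c * of_real x)) (at (of_real x))"
      using c by (auto intro!: derivative_eq_intros)
    hence "((\<lambda>\<theta>. exp (c * of_real \<theta>) / c) has_vector_derivative exp (c * of_real x)) (at x)"
      by (rule has_vector_derivative_real_field)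
    thus "((\<lambda>\<theta>. exp (c * of_real \<theta>) / c) has_vector_derivative exp (c * of_real x)) (at x within {-pi..pi})"
      by (rule has_vector_derivative_at_within)
  qed (auto intro!: continuous_intros)
  also have "\<dots> = 0"
  proof -
    have "sin (of_int j * pi) = 0" using sin_zero_iff_int2 by blast
    hence "cis (of_int j * pi) = cis (of_int j * (-pi))" by (simp add: complex_eq_iff)
    thus ?thesis unfolding cis_eq by simp
  qed
  finally show ?thesis using False by simp
qed (simp add: scaleR_conv_of_real)

text \<open>Termwise integration leaves only the term m = n. It is justified by absolute convergence
  at radius t, which is uniform in the angle.\<close>

lemma integral_eval_fps_cis:
  fixes f :: "complex fps"
  assumes t: "0 \<le> t" "ereal t < fps_conv_radius f"
  shows "(\<integral>\<theta>. indicator {-pi..pi} \<theta> *\<^sub>R (eval_fps f (t * cis \<theta>) * cis (- (real n * \<theta>))) \<partial>lborel)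
           = 2 * pi * fps_nth f n * t ^ n"
proof -
  define h where "h = (\<lambda>m \<theta>. fps_nth f m * t ^ m * (indicator {-pi..pi} \<theta> *\<^sub>R cis (of_int (int m - int n) * \<theta>)))"
  have norm_h: "norm (h m \<theta>) = norm (fps_nth f m * t ^ m) * indicator {-pi..pi} \<theta>" for m \<theta>
    by (simp add: h_def norm_mult)
  have sum: "summable (\<lambda>m. norm (fps_nth f m * t ^ m))"
    using norm_summable_fps[of "of_real t" f] t by simp
  have *: "(\<lambda>m. integral\<^sup>L lborel (h m)) sums (\<integral>\<theta>. (\<Sum>m. h m \<theta>) \<partial>lborel)"
  proof (rule sums_integral)
    show "integrable lborel (h m)" for m
      unfolding h_def
      by (intro integrable_mult_right borel_integrable_compact continuous_intros) auto
    show "AE \<theta> in lborel. summable (\<lambda>m. norm (h m \<theta>))"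
      unfolding norm_h using sum by (intro AE_I2 summable_mult2)
    show "summable (\<lambda>m. \<integral>\<theta>. norm (h m \<theta>) \<partial>lborel)"
      unfolding norm_h using sum by (simp add: summable_mult2)
  qed
  have "integral\<^sup>L lborel (h m) = (if m = n then 2 * pi * fps_nth f n * t ^ n else 0)" for m
    unfolding h_def integral_mult_right_zero integral_cis by simp
  hence "(\<lambda>m. integral\<^sup>L lborel (h m)) sums (2 * pi * fps_nth f n * t ^ n)"
    using sums_If_finite_set[of "{n}" "\<lambda>m. 2 * pi * fps_nth f n * t ^ n"] by simp
  with * have "(\<integral>\<theta>. (\<Sum>m. h m \<theta>) \<partial>lborel) = 2 * pi * fps_nth f n * t ^ n"
    by (rule sums_unique2)
  moreover have "(\<Sum>m. h m \<theta>) = indicator {-pi..pi} \<theta> *\<^sub>R (eval_fps f (t * cis \<theta>) * cis (- (real n * \<theta>)))" for \<theta>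
  proof -
    have "(\<lambda>m. fps_nth f m * (t * cis \<theta>) ^ m * (indicator {-pi..pi} \<theta> *\<^sub>R cis (- (real n * \<theta>)))) sums
           (eval_fps f (t * cis \<theta>) * (indicator {-pi..pi} \<theta> *\<^sub>R cis (- (real n * \<theta>))))"
      using t by (intro sums_mult2 sums_eval_fps) (simp add: norm_mult)
    moreover have "fps_nth f m * (t * cis \<theta>) ^ m * (indicator {-pi..pi} \<theta> *\<^sub>R cis (- (real n * \<theta>))) = h m \<theta>" for m
      by (simp add: h_def power_mult_distrib Complex.DeMoivre cis_mult scaleR_conv_of_real mult_ac algebra_simps)
    ultimately show ?thesis by (simp add: sums_iff)
  qed
  ultimately show ?thesis by simp
qed

section \<open>The characteristic function and its powers\<close>

context coeff_series
begin

text \<open>The characteristic function of a sample of the tilted law minus its mean.\<close>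

definition centred_char :: "real \<Rightarrow> real \<Rightarrow> complex" where
  "centred_char t \<theta> = (\<Sum>n. of_real (weight t n) * cis ((real n - mean t) * \<theta>))"

lemma summable_centred_char:
  assumes "0 \<le> t" "t < R"
  shows "summable (\<lambda>n. of_real (weight t n) * cis ((real n - mean t) * \<theta>))"
proof (rule summable_norm_cancel)
  show "summable (\<lambda>n. norm (of_real (weight t n) * cis ((real n - mean t) * \<theta>)))"
    using sums_summable[OF weight_sums[OF assms]] weight_nonneg[OF assms] by (simp add: norm_mult)
qed

lemma borel_measurable_centred_char [measurable]: "centred_char t \<in> borel_measurable borel"
proof -
  have "(\<lambda>\<theta>. of_real (weight t n) * cis ((real n - mean t) * \<theta>)) \<in> borel_measurable borel" for n
    by (intro borel_measurable_continuous_onI continuous_intros)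
  thus ?thesis unfolding centred_char_def[abs_def] by (rule borel_measurable_suminf)
qed

lemma centred_char_eq_eval_fps:
  assumes "0 \<le> t" "t < R"
  defines "f \<equiv> Abs_fps (\<lambda>n. complex_of_real (a n))"
  shows "ereal t < fps_conv_radius f"
    and "centred_char t \<theta> = eval_fps f (t * cis \<theta>) * cis (- (mean t * \<theta>)) / moment 0 t"
proof -
  \<comment> \<open>Summability at a larger radius puts t strictly inside the disc of
    convergence.\<close>
  obtain r where r: "t < r" "r < R" using dense[OF assms(2)] by blast
  have "summable (\<lambda>n. complex_of_real (a n * r ^ n))"
    unfolding summable_complex_of_real using r assms by (intro summable_a) auto
  hence "ereal (norm (complex_of_real r)) \<le> conv_radius (fps_nth f)"
    by (intro conv_radius_geI) (simp add: f_def)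
  moreover have "ereal t < ereal (norm (complex_of_real r))" using r assms by simp
  ultimately show radius: "ereal t < fps_conv_radius f"
    unfolding fps_conv_radius_def by (rule less_le_trans[rotated])
  have "(\<lambda>n. fps_nth f n * (t * cis \<theta>) ^ n * (cis (- (mean t * \<theta>)) / moment 0 t)) sums
          (eval_fps f (t * cis \<theta>) * (cis (- (mean t * \<theta>)) / moment 0 t))"
    using radius assms by (intro sums_mult2 sums_eval_fps) (simp add: norm_mult)
  moreover have "fps_nth f n * (t * cis \<theta>) ^ n * (cis (- (mean t * \<theta>)) / moment 0 t)
      = of_real (weight t n) * cis ((real n - mean t) * \<theta>)" for n
  proof -
    have phase: "cis (real n * \<theta>) * cis (- (mean t * \<theta>)) = cis ((real n - mean t) * \<theta>)"
      by (simp add: cis_mult algebra_simps)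
    show ?thesis
      unfolding phase[symmetric]
      by (simp add: f_def weight_def power_mult_distrib Complex.DeMoivre)
  qed
  ultimately show "centred_char t \<theta> = eval_fps f (t * cis \<theta>) * cis (- (mean t * \<theta>)) / moment 0 t"
    by (simp add: centred_char_def sums_iff)
qed

text \<open>Cauchy's coefficient formula on the circle of radius \<open>t\<close>, whose radius is tuned so that
  the phase \<open>cis (- n \<theta>)\<close> is exactly absorbed by centring.\<close>

lemma conv_power_eq_integral:
  assumes "0 < t" "t < R" "real k * mean t = real n"
  shows "complex_of_real (conv_power a k n) =
           moment 0 t ^ k / t ^ n / (2 * pi) * (\<integral>\<theta>. indicator {-pi..pi} \<theta> *\<^sub>R centred_char t \<theta> ^ k \<partial>lborel)"
proof -
  define f where "f = Abs_fps (\<lambda>n. complex_of_real (a n))"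
  define g where "g = complex_of_real (moment 0 t)"
  have g: "g \<noteq> 0" using moment_0_pos[of t] assms by (simp add: g_def)
  have radius: "ereal t < fps_conv_radius f"
    unfolding f_def using assms by (intro centred_char_eq_eval_fps) auto
  have radius': "ereal t < fps_conv_radius (f ^ k)"
    using radius fps_conv_radius_power[of f k] by (rule less_le_trans)
  have nth: "fps_nth (f ^ k) n = of_real (conv_power a k n)"
    unfolding f_def by (rule of_real_conv_power[symmetric])
  have "centred_char t \<theta> ^ k = eval_fps (f ^ k) (t * cis \<theta>) * cis (- (real n * \<theta>)) / g ^ k" for \<theta>
  proof -
    have "centred_char t \<theta> ^ k = eval_fps f (t * cis \<theta>) ^ k * cis (- (mean t * \<theta>)) ^ k / g ^ k"
      using assms centred_char_eq_eval_fps(2)[of t \<theta>]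
      by (simp add: f_def g_def power_mult_distrib power_divide)
    also have "eval_fps f (t * cis \<theta>) ^ k = eval_fps (f ^ k) (t * cis \<theta>)"
      using radius assms by (subst eval_fps_power) (auto simp: norm_mult)
    also have "cis (- (mean t * \<theta>)) ^ k = cis (- (real n * \<theta>))"
      unfolding assms(3)[symmetric] by (simp add: Complex.DeMoivre mult_ac)
    finally show ?thesis .
  qed
  hence "(\<integral>\<theta>. indicator {-pi..pi} \<theta> *\<^sub>R centred_char t \<theta> ^ k \<partial>lborel)
      = (\<integral>\<theta>. indicator {-pi..pi} \<theta> *\<^sub>R (eval_fps (f ^ k) (t * cis \<theta>) * cis (- (real n * \<theta>))) / g ^ k \<partial>lborel)"
    by (intro Bochner_Integration.integral_cong refl) (simp add: scaleR_conv_of_real)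
  also have "\<dots> = 2 * pi * of_real (conv_power a k n) * t ^ n / g ^ k"
    unfolding integral_divide_zero using radius' assms by (subst integral_eval_fps_cis) (auto simp: nth)
  finally show ?thesis using g assms by (simp add: g_def)
qed

text \<open>The atoms at 0 and 1, of masses p and q, combine to modulus at most
  \<open>p + q - p * q * (1 - cos \<theta>)\<close>; all others contribute at most their mass
  \<open>1 - (p + q)\<close>. The rate depends continuously on t, which later gives
  uniformity.\<close>

lemma norm_centred_char_le:
  assumes t: "0 \<le> t" "t < R" and \<theta>: "\<bar>\<theta>\<bar> \<le> pi"
  shows "norm (centred_char t \<theta>) \<le> exp (- (2 / pi\<^sup>2 * weight t 0 * weight t 1) * \<theta>\<^sup>2)"
proof -
  define p where "p = weight t 0"
  define q where "q = weight t 1"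
  define d where "d = 1 - cos \<theta>"
  let ?f = "\<lambda>n. of_real (weight t n) * cis ((real n - mean t) * \<theta>)"
  have p: "p \<ge> 0" and q: "q \<ge> 0" using weight_nonneg t by (auto simp: p_def q_def)
  have tail: "(\<lambda>n. weight t (n + 2)) sums (1 - (p + q))"
  proof -
    have "(\<Sum>n<2. weight t n) = p + q" by (simp add: p_def q_def numeral_2_eq_2)
    from sums_split_initial_segment[OF weight_sums[OF t], of 2, unfolded this] show ?thesis .
  qed
  have pq: "p + q \<le> 1"
    using sums_le[OF _ sums_zero tail] weight_nonneg t by auto
  have d: "0 \<le> d" "d \<le> 2" by (auto simp: d_def)
  have split: "centred_char t \<theta> = (\<Sum>n. ?f (n + 2)) + (\<Sum>n<2. ?f n)"
    unfolding centred_char_def by (rule suminf_split_initial_segment[OF summable_centred_char[OF t]])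
  have tail_le: "norm (\<Sum>n. ?f (n + 2)) \<le> 1 - (p + q)"
    unfolding sums_unique[OF tail]
    using weight_nonneg[OF t] sums_summable[OF tail] by (intro norm_suminf_le) (auto simp: norm_mult)
  have "(\<Sum>n<2. ?f n) = cis (- (mean t * \<theta>)) * (of_real p + of_real q * cis \<theta>)"
  proof -
    have "(real 0 - mean t) * \<theta> = - (mean t * \<theta>)" by simp
    moreover have "cis ((real 1 - mean t) * \<theta>) = cis (- (mean t * \<theta>)) * cis \<theta>"
      by (simp add: cis_mult left_diff_distrib)
    ultimately have "(\<Sum>n<2. ?f n) = of_real p * cis (- (mean t * \<theta>))
        + of_real q * (cis (- (mean t * \<theta>)) * cis \<theta>)"
      unfolding p_def q_def by (simp only: numeral_2_eq_2 One_nat_def sum.lessThan_Suc lessThan_0 sum.empty add_0_left)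
    thus ?thesis by (simp only: distrib_left ac_simps)
  qed
  hence head: "norm (\<Sum>n<2. ?f n) = norm (of_real p + of_real q * cis \<theta>)"
    by (simp add: norm_mult)
  have head_le: "norm (of_real p + of_real q * cis \<theta>) \<le> p + q - p * q * d"
  proof (rule power2_le_imp_le)
    have "(norm (of_real p + of_real q * cis \<theta>))\<^sup>2 = (p + q * cos \<theta>)\<^sup>2 + (q * sin \<theta>)\<^sup>2"
      by (simp add: cmod_power2)
    also have "\<dots> = p\<^sup>2 + 2 * p * q * cos \<theta> + q\<^sup>2 * ((sin \<theta>)\<^sup>2 + (cos \<theta>)\<^sup>2)"
      by (simp only: power2_eq_square algebra_simps)
    also have "\<dots> = (p + q)\<^sup>2 - 2 * (p * q * d)"
      by (simp add: d_def power2_eq_square algebra_simps)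
    \<comment> \<open>Completes the square: inserting the factor \<open>p + q\<close> \<le> 1 and
      adding a square can only increase the value.\<close>
    also have "\<dots> \<le> (p + q)\<^sup>2 - 2 * (p + q) * (p * q * d) + (p * q * d)\<^sup>2"
    proof -
      have "(p + q) * (p * q * d) \<le> 1 * (p * q * d)"
        using pq p q d by (intro mult_right_mono) auto
      thus ?thesis using zero_le_power2[of "p * q * d"] by linarith
    qed
    also have "\<dots> = (p + q - p * q * d)\<^sup>2" by (simp add: power2_eq_square algebra_simps)
    finally show "(norm (of_real p + of_real q * cis \<theta>))\<^sup>2 \<le> (p + q - p * q * d)\<^sup>2" .
    \<comment> \<open>Comparing squares requires a nonnegative right side, which follows from pqd
      \<le> 2pq \<le> p + q.\<close>
    have "p * q * d \<le> p * q * 2" using p q d by (intro mult_left_mono) auto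
    moreover have "p * q \<le> p * 1" "q * p \<le> q * 1" using p q pq by (intro mult_left_mono; simp)+
    ultimately show "0 \<le> p + q - p * q * d" by (simp add: mult.commute)
  qed
  have "norm (centred_char t \<theta>) \<le> 1 - p * q * d"
    unfolding split using tail_le head head_le norm_triangle_ineq[of "\<Sum>n. ?f (n + 2)" "\<Sum>n<2. ?f n"] by linarith
  also have "\<dots> \<le> 1 - p * q * (2 / pi\<^sup>2 * \<theta>\<^sup>2)"
    unfolding d_def using p q one_minus_cos_ge[OF \<theta>]
    by (intro diff_mono order_refl mult_left_mono) auto
  also have "\<dots> \<le> exp (- (p * q * (2 / pi\<^sup>2 * \<theta>\<^sup>2)))" by (rule exp_minus_ge)
  finally show ?thesis by (simp add: p_def q_def mult_ac)
qed

lemma norm_centred_char_le_1: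
  assumes "0 \<le> t" "t < R"
  shows "norm (centred_char t \<theta>) \<le> 1"
proof -
  have "norm (centred_char t \<theta>) \<le> (\<Sum>n. weight t n)"
    unfolding centred_char_def using sums_summable[OF weight_sums[OF assms]] weight_nonneg[OF assms]
    by (intro norm_suminf_le) (auto simp: norm_mult)
  thus ?thesis using weight_sums[OF assms] by (simp add: sums_iff)
qed

text \<open>The third moment of the sample plus its mean. It dominates the absolute third central
  moment and, being rational in the moments, is visibly continuous in t.\<close>

definition third_moment_bound :: "real \<Rightarrow> real" where
  "third_moment_bound t = (moment 3 t + 3 * mean t * moment 2 t + 3 * (mean t)\<^sup>2 * moment 1 t
                             + mean t ^ 3 * moment 0 t) / moment 0 t"

lemma isCont_third_moment_bound: "0 \<le> t \<Longrightarrow> t < R \<Longrightarrow> isCont third_moment_bound t"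
  unfolding third_moment_bound_def[abs_def] using moment_0_pos[of t]
  by (intro continuous_divide continuous_add continuous_mult continuous_power continuous_const
        isCont_moment isCont_mean) auto

text \<open>Second-order Taylor expansion under the sum: centring kills the linear term, the
  quadratic term gives the variance, and the remainder is at most
  \<open>\<bar>q n\<bar> ^ 3 / 6\<close>.\<close>

lemma centred_char_approx:
  assumes t: "0 \<le> t" "t < R"
  shows "norm (centred_char t \<theta> - of_real (1 - var t * \<theta>\<^sup>2 / 2)) \<le> \<bar>\<theta>\<bar> ^ 3 * third_moment_bound t"
proof -
  define \<mu> where "\<mu> = mean t"
  have \<mu>: "\<mu> \<ge> 0" using moment_nonneg[OF t, of 1] moment_0_pos[OF t] by (simp add: \<mu>_def mean_def)
  define q where "q = (\<lambda>n. (real n - \<mu>) * \<theta>)"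
  define f where "f = (\<lambda>n. of_real (weight t n) * (cis (q n) - (1 + \<i> * q n - (q n)\<^sup>2 / 2)))"
  have "(\<lambda>n. of_real (weight t n) * cis (q n)) sums centred_char t \<theta>"
    unfolding centred_char_def q_def \<mu>_def by (rule summable_sums[OF summable_centred_char[OF t]])
  moreover have "(\<lambda>n. of_real (weight t n) + \<i> * of_real (weight t n * (real n - \<mu>) * \<theta>)
        - of_real (weight t n * (real n - \<mu>)\<^sup>2 * (\<theta>\<^sup>2 / 2))) sums
      (of_real 1 + \<i> * of_real (0 * \<theta>) - of_real (var t * (\<theta>\<^sup>2 / 2)))"
    unfolding \<mu>_def
    by (intro sums_add sums_diff sums_mult sums_of_real sums_mult2 weight_sums weight_centred_sums
          weight_var_sums t)
  ultimately have sums: "(\<lambda>n. of_real (weight t n) * cis (q n) - (of_real (weight t n) + \<i> * of_real (weight t n * (real n - \<mu>) * \<theta>)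
        - of_real (weight t n * (real n - \<mu>)\<^sup>2 * (\<theta>\<^sup>2 / 2)))) sums
      (centred_char t \<theta> - (of_real 1 + \<i> * of_real (0 * \<theta>) - of_real (var t * (\<theta>\<^sup>2 / 2))))"
    by (rule sums_diff)
  have f: "f sums (centred_char t \<theta> - of_real (1 - var t * \<theta>\<^sup>2 / 2))"
  proof -
    have "of_real (weight t n) * cis (q n) - (of_real (weight t n) + \<i> * of_real (weight t n * (real n - \<mu>) * \<theta>)
        - of_real (weight t n * (real n - \<mu>)\<^sup>2 * (\<theta>\<^sup>2 / 2))) = f n" for n
    proof -
      have "weight t n * (real n - \<mu>) * \<theta> = weight t n * q n"
        "weight t n * (real n - \<mu>)\<^sup>2 * (\<theta>\<^sup>2 / 2) = weight t n * ((q n)\<^sup>2 / 2)"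
        by (simp_all add: q_def power_mult_distrib)
      thus ?thesis by (simp only: f_def) (simp add: algebra_simps)
    qed
    moreover have "of_real 1 + \<i> * of_real (0 * \<theta>) - of_real (var t * (\<theta>\<^sup>2 / 2))
        = complex_of_real (1 - var t * \<theta>\<^sup>2 / 2)" by simp
    ultimately show ?thesis using sums by (simp only:)
  qed
  define h where "h = (\<lambda>n. real n ^ 3 * weight t n + 3 * \<mu> * (real n ^ 2 * weight t n)
      + 3 * \<mu>\<^sup>2 * (real n ^ 1 * weight t n) + \<mu> ^ 3 * (real n ^ 0 * weight t n))"
  have h: "h sums third_moment_bound t"
  proof -
    have "h sums (moment 3 t / moment 0 t + 3 * \<mu> * (moment 2 t / moment 0 t)
        + 3 * \<mu>\<^sup>2 * (moment 1 t / moment 0 t) + \<mu> ^ 3 * (moment 0 t / moment 0 t))"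
      unfolding h_def by (intro sums_add sums_mult weight_moment_sums t)
    thus ?thesis using moment_0_pos[OF t] by (simp add: third_moment_bound_def \<mu>_def add_divide_distrib)
  qed
  have le: "norm (f n) \<le> \<bar>\<theta>\<bar> ^ 3 * h n" for n
  proof -
    have "norm (cis (q n) - (1 + \<i> * q n - (q n)\<^sup>2 / 2)) \<le> \<bar>q n\<bar> ^ 3 / 6"
    proof -
      have "(\<Sum>m\<le>2. (\<i> * of_real (q n)) ^ m / fact m) = 1 + \<i> * q n - (q n)\<^sup>2 / 2"
      proof -
        have "(\<i> * of_real (q n))\<^sup>2 = - complex_of_real ((q n)\<^sup>2)" by (simp add: power_mult_distrib)
        moreover have "(\<Sum>m\<le>2. (\<i> * of_real (q n)) ^ m / fact m)
            = 1 + \<i> * q n + (\<i> * of_real (q n))\<^sup>2 / 2"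
          by (simp add: numeral_2_eq_2)
        ultimately show ?thesis by simp
      qed
      moreover have "fact (Suc 2) = (6::real)" "Suc 2 = 3" by (simp_all add: fact_reduce)
      ultimately show ?thesis
        using iexp_approx1[of "q n" 2] unfolding cis_conv_exp by (simp only:)
    qed
    also have "\<dots> \<le> \<bar>q n\<bar> ^ 3" by simp
    also have "\<dots> = \<bar>real n - \<mu>\<bar> ^ 3 * \<bar>\<theta>\<bar> ^ 3" by (simp add: q_def abs_mult power_mult_distrib)
    also have "\<dots> \<le> (real n + \<mu>) ^ 3 * \<bar>\<theta>\<bar> ^ 3"
      using \<mu> by (intro mult_right_mono power_mono) auto
    finally have "weight t n * norm (cis (q n) - (1 + \<i> * q n - (q n)\<^sup>2 / 2))
        \<le> weight t n * ((real n + \<mu>) ^ 3 * \<bar>\<theta>\<bar> ^ 3)"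
      by (rule mult_left_mono[OF _ weight_nonneg[OF t]])
    also have "\<dots> = \<bar>\<theta>\<bar> ^ 3 * h n"
      by (simp add: h_def power3_eq_cube power2_eq_square algebra_simps)
    finally show ?thesis using weight_nonneg[OF t] by (simp add: f_def norm_mult)
  qed
  have "norm (\<Sum>n. f n) \<le> (\<Sum>n. \<bar>\<theta>\<bar> ^ 3 * h n)"
    using le h by (intro norm_suminf_le summable_mult) (auto simp: sums_iff)
  also have "\<dots> = \<bar>\<theta>\<bar> ^ 3 * third_moment_bound t"
    using sums_mult[OF h] by (simp add: sums_iff)
  finally show ?thesis using f by (simp add: sums_iff)
qed

text \<open>Each factor is within O(k^(-3/2)) of a Gaussian factor, so the k-th powers differ by
  O(k^(-1/2)).\<close>

lemma centred_char_power_tendsto: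
  assumes k: "filterlim k at_top sequentially" and t: "t \<longlonglongrightarrow> u" and u: "0 < u" "u < R"
  shows "(\<lambda>n. centred_char (t n) (x / sqrt (real (k n))) ^ k n) \<longlonglongrightarrow> of_real (exp (- (var u / 2) * x\<^sup>2))"
proof -
  \<comment> \<open>The Gaussian takes the variance at \<open>t n\<close>, so the comparison is pure
    Taylor error; continuity of the variance moves it to \<open>u\<close> separately.\<close>
  define E where "E = (\<lambda>n. exp (- (var (t n) / 2) * x\<^sup>2))"
  have E: "E \<longlonglongrightarrow> exp (- (var u / 2) * x\<^sup>2)"
    unfolding E_def using u by (intro tendsto_intros isCont_tendsto_compose[OF isCont_var t]) auto
  have "filterlim (\<lambda>n. real (k n)) at_top sequentially"
    by (rule filterlim_compose[OF filterlim_real_sequentially k])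
  hence inv: "(\<lambda>n. inverse (real (k n))) \<longlonglongrightarrow> 0"
    by (rule tendsto_inverse_0_at_top)
  have inv_sqrt: "(\<lambda>n. sqrt (inverse (real (k n)))) \<longlonglongrightarrow> 0"
    using tendsto_real_sqrt[OF inv] by simp
  have "(\<lambda>n. centred_char (t n) (x / sqrt (real (k n))) ^ k n - of_real (E n)) \<longlonglongrightarrow> 0"
  proof (rule Lim_null_comparison)
    have "(\<lambda>n. \<bar>x\<bar> ^ 3 * third_moment_bound (t n) * sqrt (inverse (real (k n)))
            + (var (t n) / 2 * x\<^sup>2)\<^sup>2 * inverse (real (k n))) \<longlonglongrightarrow>
          \<bar>x\<bar> ^ 3 * third_moment_bound u * 0 + (var u / 2 * x\<^sup>2)\<^sup>2 * 0"
      using u by (intro tendsto_intros inv inv_sqrt isCont_tendsto_compose[OF isCont_var t]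
          isCont_tendsto_compose[OF isCont_third_moment_bound t]) auto
    thus "(\<lambda>n. \<bar>x\<bar> ^ 3 * third_moment_bound (t n) * sqrt (inverse (real (k n)))
            + (var (t n) / 2 * x\<^sup>2)\<^sup>2 * inverse (real (k n))) \<longlonglongrightarrow> 0" by simp
    have "\<forall>\<^sub>F n in sequentially. 0 < t n" "\<forall>\<^sub>F n in sequentially. t n < R"
      using order_tendstoD[OF t] u by auto
    moreover have "\<forall>\<^sub>F n in sequentially. 0 < k n"
      using k by (rule eventually_compose_filterlim[OF eventually_gt_at_top])
    ultimately show "\<forall>\<^sub>F n in sequentially. norm (centred_char (t n) (x / sqrt (real (k n))) ^ k n - of_real (E n))
        \<le> \<bar>x\<bar> ^ 3 * third_moment_bound (t n) * sqrt (inverse (real (k n)))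
            + (var (t n) / 2 * x\<^sup>2)\<^sup>2 * inverse (real (k n))"
    proof eventually_elim
      case (elim n)
      define K where "K = real (k n)"
      define \<theta> where "\<theta> = x / sqrt K"
      define y where "y = var (t n) / 2 * \<theta>\<^sup>2"
      have K: "K > 0" using elim by (simp add: K_def)
      have \<theta>2: "\<theta>\<^sup>2 = x\<^sup>2 / K" using K by (simp add: \<theta>_def power_divide)
      have \<theta>3: "K * \<bar>\<theta>\<bar> ^ 3 = \<bar>x\<bar> ^ 3 * sqrt (inverse K)"
      proof -
        have "K * \<bar>\<theta>\<bar> ^ 3 = K * (\<theta>\<^sup>2 * \<bar>\<theta>\<bar>)" by (simp add: power3_eq_cube power2_eq_square)
        also have "\<dots> = x\<^sup>2 * (\<bar>x\<bar> / sqrt K)"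
          unfolding \<theta>2 using K by (simp add: \<theta>_def)
        also have "\<dots> = \<bar>x\<bar> ^ 3 * sqrt (inverse K)"
          by (simp add: power3_eq_cube power2_eq_square real_sqrt_inverse divide_inverse)
        finally show ?thesis .
      qed
      have y: "y \<ge> 0" using var_pos[of "t n"] elim by (simp add: y_def)
      have E_eq: "of_real (E n) = complex_of_real (exp (- y)) ^ k n"
        using K by (simp add: E_def y_def \<theta>2 K_def flip: exp_of_nat_mult of_real_power)
      \<comment> \<open>Numbers of modulus at most 1 have k-th powers that differ by at most k times
        their difference.\<close>
      have "norm (centred_char (t n) \<theta> ^ k n - of_real (E n))
          \<le> K * norm (centred_char (t n) \<theta> - of_real (exp (- y)))"
        unfolding E_eq K_def using elim y by (intro norm_power_diff norm_centred_char_le_1) auto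
      also have "\<dots> \<le> K * (\<bar>\<theta>\<bar> ^ 3 * third_moment_bound (t n) + y\<^sup>2)"
      proof (rule mult_left_mono)
        have "norm (centred_char (t n) \<theta> - of_real (1 - y)) \<le> \<bar>\<theta>\<bar> ^ 3 * third_moment_bound (t n)"
          using centred_char_approx[of "t n" \<theta>] elim by (simp add: y_def)
        moreover have "norm (complex_of_real (1 - y) - of_real (exp (- y))) \<le> y\<^sup>2"
          using abs_exp_minus_linear_le[OF y]
          unfolding of_real_diff[symmetric] norm_of_real by (simp add: abs_minus_commute)
        ultimately show "norm (centred_char (t n) \<theta> - of_real (exp (- y)))
            \<le> \<bar>\<theta>\<bar> ^ 3 * third_moment_bound (t n) + y\<^sup>2"
          by (rule norm_diff_triangle_le)
      qed (use K in simp)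
      also have "\<dots> = (K * \<bar>\<theta>\<bar> ^ 3) * third_moment_bound (t n) + K * y\<^sup>2"
        by (simp add: algebra_simps)
      also have "K * y\<^sup>2 = (var (t n) / 2 * x\<^sup>2)\<^sup>2 * inverse K"
        unfolding y_def \<theta>2 using K by (simp add: power2_eq_square field_simps)
      finally show ?case using K unfolding \<theta>3 by (simp add: K_def \<theta>_def mult_ac)
    qed
  qed
  from tendsto_add[OF this tendsto_of_real[OF E]] show ?thesis by simp
qed

text \<open>Substituting \<open>x / sqrt (real (k n))\<close> for the angle turns the integral into
  one over the whole line, with a Gaussian pointwise limit and a Gaussian majorant.\<close>

lemma centred_char_power_integral_tendsto:
  assumes k: "filterlim k at_top sequentially" and t: "t \<longlonglongrightarrow> u" and u: "0 < u" "u < R"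
  shows "(\<lambda>n. sqrt (real (k n)) * (\<integral>\<theta>. indicator {-pi..pi} \<theta> *\<^sub>R centred_char (t n) \<theta> ^ k n \<partial>lborel))
            \<longlonglongrightarrow> of_real (sqrt (2 * pi / var u))"
proof -
  \<comment> \<open>The rate in \<open>norm_centred_char_le\<close>. It is continuous and positive
    at \<open>u\<close>, so half its value there serves all large n and gives a single
    majorant.\<close>
  define c where "c = (\<lambda>s. 2 / pi\<^sup>2 * weight s 0 * weight s 1)"
  define s where "s = (\<lambda>n x. indicator {-pi..pi} (x / sqrt (real (k n))) *\<^sub>R centred_char (t n) (x / sqrt (real (k n))) ^ k n)"
  have "c u > 0"
    using u a0_pos a1_pos moment_0_pos[of u] by (simp add: c_def weight_def)
  have "isCont c u"
    unfolding c_def weight_def using u moment_0_pos[of u] by (intro continuous_intros isCont_moment) auto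
  hence "(\<lambda>n. c (t n)) \<longlonglongrightarrow> c u" using t by (rule isCont_tendsto_compose)
  hence c_ev: "\<forall>\<^sub>F n in sequentially. c u / 2 < c (t n)"
    using \<open>c u > 0\<close> by (intro order_tendstoD) auto
  have ev: "\<forall>\<^sub>F n in sequentially. 0 < k n" "\<forall>\<^sub>F n in sequentially. 0 < t n" "\<forall>\<^sub>F n in sequentially. t n < R"
    using eventually_compose_filterlim[OF eventually_gt_at_top k] order_tendstoD[OF t] u by auto
  have "\<forall>\<^sub>F n in sequentially. \<forall>x. norm (s n x) \<le> exp (- (c u / 2) * x\<^sup>2)"
    using c_ev ev
  proof eventually_elim
    case (elim n)
    show ?case
    proof
      fix x
      define \<theta> where "\<theta> = x / sqrt (real (k n))"
      have k\<theta>: "real (k n) * \<theta>\<^sup>2 = x\<^sup>2" using elim by (simp add: \<theta>_def power_divide)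
      show "norm (s n x) \<le> exp (- (c u / 2) * x\<^sup>2)"
      proof (cases "\<theta> \<in> {-pi..pi}")
        case True
        hence "norm (s n x) = norm (centred_char (t n) \<theta>) ^ k n"
          by (simp add: s_def norm_power flip: \<theta>_def)
        also have "\<dots> \<le> exp (- c (t n) * \<theta>\<^sup>2) ^ k n"
          unfolding c_def using elim True by (intro power_mono norm_centred_char_le) auto
        also have "\<dots> = exp (- c (t n) * (real (k n) * \<theta>\<^sup>2))"
          by (simp add: mult_ac flip: exp_of_nat_mult)
        also have "\<dots> \<le> exp (- (c u / 2) * x\<^sup>2)"
          unfolding k\<theta> using elim mult_right_mono[of "c u / 2" "c (t n)" "x\<^sup>2"] by simp
        finally show ?thesis .
      qed (simp add: s_def flip: \<theta>_def)
    qed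
  qed
  then obtain N where N: "\<And>n x. n \<ge> N \<Longrightarrow> norm (s n x) \<le> exp (- (c u / 2) * x\<^sup>2)"
    unfolding eventually_sequentially by blast
  \<comment> \<open>The majorant holds from \<open>N\<close> on, hence the shift, which is removed
    after the limit.\<close>
  have "(\<lambda>n. integral\<^sup>L lborel (s (n + N))) \<longlonglongrightarrow> (\<integral>x. complex_of_real (exp (- (var u / 2) * x\<^sup>2)) \<partial>lborel)"
  proof (rule integral_dominated_convergence)
    show "integrable lborel (\<lambda>x. exp (- (c u / 2) * x\<^sup>2))"
      using \<open>c u > 0\<close> by (intro integral_exp_minus_square) auto
    show "AE x in lborel. norm (s (n + N) x) \<le> exp (- (c u / 2) * x\<^sup>2)" for n
      using N by simp
    show "AE x in lborel. (\<lambda>n. s (n + N) x) \<longlonglongrightarrow> complex_of_real (exp (- (var u / 2) * x\<^sup>2))"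
    proof (rule AE_I2)
      fix x :: real
      have "(\<lambda>n. s n x) \<longlonglongrightarrow> 1 *\<^sub>R complex_of_real (exp (- (var u / 2) * x\<^sup>2))"
        unfolding s_def
      proof (intro tendsto_scaleR centred_char_power_tendsto[OF k t u] tendsto_eventually)
        have "filterlim (\<lambda>n. sqrt (real (k n))) at_top sequentially"
          by (intro filterlim_compose[OF sqrt_at_top] filterlim_compose[OF filterlim_real_sequentially k])
        \<comment> \<open>For fixed x the growing window eventually contains x, and the indicator is
          then 1.\<close>
        hence "\<forall>\<^sub>F n in sequentially. sqrt (real (k n)) > \<bar>x\<bar> / pi"
          by (simp add: filterlim_at_top_dense)
        thus "\<forall>\<^sub>F n in sequentially. indicator {-pi..pi} (x / sqrt (real (k n))) = (1::real)"
          using ev(1)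
        proof eventually_elim
          case (elim n)
          hence "\<bar>x\<bar> / sqrt (real (k n)) \<le> pi" by (simp add: field_simps)
          hence "\<bar>x / sqrt (real (k n))\<bar> \<le> pi" by (simp add: abs_divide)
          thus ?case unfolding abs_le_iff by (simp add: indicator_def)
        qed
      qed
      thus "(\<lambda>n. s (n + N) x) \<longlonglongrightarrow> complex_of_real (exp (- (var u / 2) * x\<^sup>2))"
        by (intro LIMSEQ_ignore_initial_segment) simp
    qed
  qed (auto simp: s_def)
  hence "(\<lambda>n. integral\<^sup>L lborel (s n)) \<longlonglongrightarrow> (\<integral>x. complex_of_real (exp (- (var u / 2) * x\<^sup>2)) \<partial>lborel)"
    by (rule LIMSEQ_offset)
  also have "(\<integral>x. complex_of_real (exp (- (var u / 2) * x\<^sup>2)) \<partial>lborel) = of_real (sqrt (2 * pi / var u))"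
    using var_pos[OF u] integral_exp_minus_square(2)[of "var u / 2"]
    by (simp only: integral_complex_of_real) (simp add: mult_ac)
  finally show ?thesis
  proof (rule Lim_transform_eventually)
    show "\<forall>\<^sub>F n in sequentially. integral\<^sup>L lborel (s n) =
        sqrt (real (k n)) * (\<integral>\<theta>. indicator {-pi..pi} \<theta> *\<^sub>R centred_char (t n) \<theta> ^ k n \<partial>lborel)"
      using ev(1)
    proof eventually_elim
      case (elim n)
      show ?case
        using elim lborel_integral_real_affine[of "1 / sqrt (real (k n))"
            "\<lambda>\<theta>. indicator {-pi..pi} \<theta> *\<^sub>R centred_char (t n) \<theta> ^ k n" 0]
        by (simp add: s_def[abs_def] scaleR_conv_of_real)
    qed
  qed
qed

text \<open>By the coefficient formula the exponential factor cancels exactly from the quotient, and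
  the rescaled Fourier integral that remains tends to 1. The limit is taken over the complex numbers
  and then read back over the reals.\<close>

lemma conv_power_asymp_equiv:
  assumes k: "filterlim k at_top sequentially" and t: "t \<longlonglongrightarrow> u" and u: "0 < u" "u < R"
    and saddle: "\<forall>\<^sub>F n in sequentially. real (k n) * mean (t n) = real n"
  shows "(\<lambda>n. conv_power a (k n) n) \<sim>[sequentially]
         (\<lambda>n. exp (real (k n) * ln (moment 0 (t n)) - real n * ln (t n)) * (1 / sqrt (2 * pi * real (k n) * var u)))"
    (is "_ \<sim>[_] ?g")
proof (rule asymp_equivI')
  let ?I = "\<lambda>n. \<integral>\<theta>. indicator {-pi..pi} \<theta> *\<^sub>R centred_char (t n) \<theta> ^ k n \<partial>lborel"
  define V where "V = var u"
  have V: "V > 0" using var_pos[OF u] by (simp add: V_def)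
  have "(\<lambda>n. of_real (sqrt (V / (2 * pi))) * (sqrt (real (k n)) * ?I n)) \<longlonglongrightarrow>
           of_real (sqrt (V / (2 * pi))) * of_real (sqrt (2 * pi / V))"
    unfolding V_def by (intro tendsto_intros centred_char_power_integral_tendsto k t u)
  also have "of_real (sqrt (V / (2 * pi))) * complex_of_real (sqrt (2 * pi / V)) = 1"
    using V by (simp flip: of_real_mult real_sqrt_mult)
  finally have lim: "(\<lambda>n. of_real (sqrt (V / (2 * pi))) * (sqrt (real (k n)) * ?I n)) \<longlonglongrightarrow> 1" .
  have ev: "\<forall>\<^sub>F n in sequentially. 0 < k n" "\<forall>\<^sub>F n in sequentially. 0 < t n" "\<forall>\<^sub>F n in sequentially. t n < R"
    using eventually_compose_filterlim[OF eventually_gt_at_top k] order_tendstoD[OF t] u by auto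
  have "(\<lambda>n. complex_of_real (conv_power a (k n) n / ?g n)) \<longlonglongrightarrow> of_real 1"
    unfolding of_real_1 using lim
  proof (rule Lim_transform_eventually)
    show "\<forall>\<^sub>F n in sequentially. of_real (sqrt (V / (2 * pi))) * (sqrt (real (k n)) * ?I n) =
            complex_of_real (conv_power a (k n) n / ?g n)"
      using ev saddle
    proof eventually_elim
      case (elim n)
      define A where "A = moment 0 (t n) ^ k n / t n ^ n"
      have g: "moment 0 (t n) > 0" using elim by (intro moment_0_pos) auto
      have A: "A > 0" using g elim by (simp add: A_def)
      have "exp (real (k n) * ln (moment 0 (t n)) - real n * ln (t n)) = A"
        using g elim by (simp add: A_def exp_diff exp_of_nat_mult)
      hence "conv_power a (k n) n / ?g n = conv_power a (k n) n / A * sqrt (2 * pi * real (k n) * V)"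
        by (simp add: V_def)
      hence "complex_of_real (conv_power a (k n) n / ?g n)
          = complex_of_real (conv_power a (k n) n) / of_real A * of_real (sqrt (2 * pi * real (k n) * V))"
        by simp
      also have "complex_of_real (conv_power a (k n) n) = of_real A / (2 * pi) * ?I n"
        using conv_power_eq_integral[of "t n" "k n" n] elim by (simp add: A_def)
      also have "of_real A / (2 * pi) * ?I n / of_real A * of_real (sqrt (2 * pi * real (k n) * V))
          = of_real (sqrt (2 * pi * real (k n) * V) / (2 * pi)) * ?I n"
        using A by simp
      also have "sqrt (2 * pi * real (k n) * V) / (2 * pi) = sqrt (V / (2 * pi)) * sqrt (real (k n))"
      proof -
        have "2 * pi = sqrt (2 * pi) * sqrt (2 * pi)" by simp
        thus ?thesis by (simp add: real_sqrt_mult real_sqrt_divide field_simps)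
      qed
      finally show ?case by simp
    qed
  qed
  thus "(\<lambda>n. conv_power a (k n) n / ?g n) \<longlonglongrightarrow> 1"
    unfolding tendsto_of_real_iff .
qed

end

section \<open>Squared central binomial coefficients\<close>

interpretation cbs: divergent_coeff_series central_binom_sq "1 / 16"
proof
  show "0 < central_binom_sq 0" "0 < central_binom_sq 1" "\<And>n. 0 \<le> central_binom_sq n"
    by (simp_all add: central_binom_sq_def)
qed (use summable_central_binom_sq not_summable_central_binom_sq in auto)

lemma moment_0_eq_genfun: "cbs.moment 0 = genfun"
  by (simp add: fun_eq_iff cbs.moment_def genfun_def)

lemma is_minimizer_iff:
  assumes "\<kappa> > 0"
  shows "is_minimizer \<kappa> t \<longleftrightarrow> 0 < t \<and> t < 1 / 16 \<and> \<kappa> * cbs.mean t = 1"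
  using cbs.arg_min_iff_mean[OF assms] by (simp only: is_minimizer_def moment_0_eq_genfun)

lemma ex1_is_minimizer:
  assumes "\<kappa> > 0"
  shows "\<exists>!t. is_minimizer \<kappa> t"
proof -
  obtain t where t: "0 < t" "t < 1 / 16" "cbs.mean t = 1 / \<kappa>"
    using cbs.mean_surj[of "1 / \<kappa>"] assms by auto
  show ?thesis
  proof (rule ex1I)
    show "is_minimizer \<kappa> t" using t assms by (simp add: is_minimizer_iff)
    fix s assume "is_minimizer \<kappa> s"
    hence s: "0 < s" "s < 1 / 16" "cbs.mean s = 1 / \<kappa>"
      using assms by (auto simp: is_minimizer_iff field_simps)
    show "s = t"
      using s t cbs.mean_strict_mono[of s t] cbs.mean_strict_mono[of t s] by linarith
  qed
qed

lemma T_star: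
  assumes "\<kappa> > 0"
  shows "0 < T_star \<kappa>" "T_star \<kappa> < 1 / 16" "\<kappa> * cbs.mean (T_star \<kappa>) = 1"
  using theI'[OF ex1_is_minimizer[OF assms]] assms
  unfolding T_star_def[symmetric] by (simp_all add: is_minimizer_iff)

lemma asym_var_eq: "\<kappa> > 0 \<Longrightarrow> asym_var \<kappa> = cbs.var (T_star \<kappa>)"
  using cbs.var_eq_log_derivatives[of "T_star \<kappa>"] T_star[of \<kappa>]
  by (simp add: asym_var_def Let_def moment_0_eq_genfun)

text \<open>The mean at \<open>T_star (k / n)\<close> is n / k, so the saddle equation is exact for
  each large n. As n / k tends to \<open>inverse \<kappa>\<close>, the saddle points converge to
  \<open>T_star \<kappa>\<close>.\<close>

lemma conv_power_central_binom_sq_asymp_equiv: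
  assumes \<kappa>: "\<kappa> > 0" and lim: "(\<lambda>n. real (k n) / real n) \<longlonglongrightarrow> \<kappa>"
  shows "(\<lambda>n. conv_power central_binom_sq (k n) n) \<sim>[sequentially]
      (\<lambda>n. exp (real (k n) * ln (genfun (T_star (real (k n) / real n)))
                  - real n * ln (T_star (real (k n) / real n)))
            * (1 / sqrt (2 * pi * real (k n) * asym_var \<kappa>)))"
proof -
  define t where "t = (\<lambda>n. T_star (real (k n) / real n))"
  have pos: "\<forall>\<^sub>F n in sequentially. real (k n) / real n > 0"
    using order_tendstoD(1)[OF lim \<kappa>] .
  have mean: "cbs.mean (T_star \<kappa>) = inverse \<kappa>" if "\<kappa> > 0" for \<kappa>
    using T_star[OF that] that by (simp add: field_simps)
  \<comment> \<open>Writing k as (k / n) * n shows that it tends to infinity.\<close>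
  have "filterlim (\<lambda>n. real (k n) / real n * real n) at_top sequentially"
    by (rule filterlim_tendsto_pos_mult_at_top[OF lim \<kappa> filterlim_real_sequentially])
  moreover have "\<forall>\<^sub>F n in sequentially. real (k n) / real n * real n = real (k n)"
    using eventually_gt_at_top[of 0] by eventually_elim simp
  ultimately have "filterlim (\<lambda>n. real (k n)) at_top sequentially"
    by (rule iffD1[OF filterlim_cong[OF refl refl], rotated])
  hence k: "filterlim k at_top sequentially"
    by (simp add: filterlim_sequentially_iff_filterlim_real)
  have "t \<longlonglongrightarrow> T_star \<kappa>"
  proof (rule cbs.mean_eq_tendsto)
    show "\<forall>\<^sub>F n in sequentially. 0 < t n \<and> t n < 1 / 16"
      using pos unfolding t_def by eventually_elim (blast intro: T_star)
    have "(\<lambda>n. inverse (real (k n) / real n)) \<longlonglongrightarrow> inverse \<kappa>"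
      using \<kappa> by (intro tendsto_inverse lim) auto
    thus "(\<lambda>n. cbs.mean (t n)) \<longlonglongrightarrow> cbs.mean (T_star \<kappa>)"
      unfolding mean[OF \<kappa>]
    proof (rule Lim_transform_eventually)
      show "\<forall>\<^sub>F n in sequentially. inverse (real (k n) / real n) = cbs.mean (t n)"
        using pos by eventually_elim (simp add: t_def mean)
    qed
  qed (use T_star[OF \<kappa>] in auto)
  moreover have "\<forall>\<^sub>F n in sequentially. real (k n) * cbs.mean (t n) = real n"
    using pos
  proof eventually_elim
    case (elim n)
    \<comment> \<open>Division by zero gives 0, so a positive quotient forces both numbers to be
      nonzero.\<close>
    hence "real (k n) \<noteq> 0" "real n \<noteq> 0" by (auto simp only: div_0 div_by_0)
    with mean[OF elim] show ?case by (simp add: t_def)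
  qed
  ultimately have "(\<lambda>n. conv_power central_binom_sq (k n) n) \<sim>[sequentially]
         (\<lambda>n. exp (real (k n) * ln (cbs.moment 0 (t n)) - real n * ln (t n))
               * (1 / sqrt (2 * pi * real (k n) * cbs.var (T_star \<kappa>))))"
    using T_star[OF \<kappa>] k by (intro cbs.conv_power_asymp_equiv) auto
  thus ?thesis
    by (simp only: moment_0_eq_genfun asym_var_eq[OF \<kappa>] t_def)
qed

theorem theorem12:
  "(\<forall>t\<in>{0..<1/16}. genfun t = 2 / pi * elliptic_K (16 * t)) \<and>
   (\<forall>\<kappa>>0. \<exists>!t. is_minimizer \<kappa> t) \<and>
   (\<forall>(\<kappa>::real) (k :: nat \<Rightarrow> nat).
      \<kappa> > 0 \<longrightarrow> (\<lambda>n. real (k n) / real n) \<longlonglongrightarrow> \<kappa> \<longrightarrow>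
      (\<lambda>n. conv_power central_binom_sq (k n) n) \<sim>[sequentially]
      (\<lambda>n. exp (real (k n) * ln (genfun (T_star (real (k n) / real n)))
                  - real n * ln (T_star (real (k n) / real n)))
            * (1 / sqrt (2 * pi * real (k n) * asym_var \<kappa>))))"
  using genfun_eq_elliptic_K ex1_is_minimizer conv_power_central_binom_sq_asymp_equiv by simp

end
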